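(* Let $A,B\in\mathbb{Z}$ satisfy $|A|\leq B$ and $2|A|\geq B+3$, and let $T$ be the tile defined below. Then $T$ is not disk-like.
   Context: Let $a(x,y)=(x+1,y)$ and $c(x,y)=(-x,-y)$. Let $g(\mathbf{x})=\begin{pmatrix}0&-B\\1&-A\end{pmatrix}\mathbf{x}+\left(\frac{B-1}{2},0\right)^T$, $\mathcal{D}=\{id,a,\dots,a^{B-2},c\}$ (note $B\geq 3$ under the hypotheses), and let $T$ be the unique nonempty compact set with $g(T)=\bigcup_{\delta\in\mathcal{D}}\delta(T)$. Disk-like means homeomorphic to a closed disk. *)

theory Defs
  imports "HOL-Analysis.Analysis"
begin

definition tile_a :: "real \<times> real \<Rightarrow> real \<times> real" where
  "tile_a p = (fst p + 1, snd p)"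

definition tile_c :: "real \<times> real \<Rightarrow> real \<times> real" where
  "tile_c p = (- fst p, - snd p)"

text \<open>g(x) = M x + ((B-1)/2, 0) with M = [[0,-B],[1,-A]].\<close>
definition tile_g :: "int \<Rightarrow> int \<Rightarrow> real \<times> real \<Rightarrow> real \<times> real" where
  "tile_g A B p = (- real_of_int B * snd p + (real_of_int B - 1) / 2,
                   fst p - real_of_int A * snd p)"

definition tile_digits :: "int \<Rightarrow> (real \<times> real \<Rightarrow> real \<times> real) set" where
  "tile_digits B = (\<lambda>k. tile_a ^^ k) ` {0..nat B - 2} \<union> {tile_c}"

definition tile :: "int \<Rightarrow> int \<Rightarrow> (real \<times> real) set" where
  "tile A B = (THE T. T \<noteq> {} \<and> compact T \<and>
      tile_g A B ` T = (\<Union>\<delta>\<in>tile_digits B. \<delta> ` T))"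

definition disk_like :: "(real \<times> real) set \<Rightarrow> bool" where
  "disk_like S \<longleftrightarrow> S homeomorphic cball (0 :: real \<times> real) 1"

end

theory Submission
  imports Defs
begin

text \<open>
  Put \<open>S = T \<union> -T\<close> and let \<open>M\<close> be the linear part of \<open>g\<close>. Then \<open>M S\<close> is the union of the \<open>B\<close>
  translates of \<open>S\<close> by \<open>-(B-1)/2, \<dots>, (B-1)/2\<close> along the first axis. As \<open>\<bar>det M\<bar> = B\<close>, these
  translates overlap in null sets, and iterating gives that \<open>S\<close> and \<open>S + m\<close> have a null intersection
  for every nonzero \<open>m \<in> \<int>\<^sup>2\<close>.

  Suppose \<open>T\<close> is a disk with interior \<open>U\<close>. Any two points of \<open>S\<close> are then joined by a path that stays in
  \<open>U \<union> -U\<close> except for its ends and one chosen point \<open>p0 \<in> T \<inter> -T\<close>. Let \<open>s = (A \<mp> 1, 1)\<close>. The condition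
  \<open>2\<bar>A\<bar> \<ge> B + 3\<close> makes \<open>S\<close> meet \<open>S + 2s\<close>, and \<open>S\<close> also meets \<open>S + (1,0)\<close>.
  Hence there is a long path through the tiles \<open>S + 2ks\<close> and another one through the tiles
  \<open>S + (0,1) + (l,0)\<close>. The two paths cross by the Poincare-Miranda theorem, although no tile
  belongs to both families, so the crossing point is one of the link points. The links can be
  chosen pairwise incongruent modulo \<open>\<int>\<^sup>2\<close>, which excludes this.
\<close>

subsection \<open>Attractors, crossing and disks\<close>

text \<open>Trace a point of \<open>K\<close> back \<open>n\<close> times through the maps, then
  apply the same maps to a fixed \<open>z\<close> in \<open>Z\<close>: the result lies in
  \<open>Z\<close> at \<open>L\<close>-distance at most a constant times \<rho>^n. Only
  \<open>K\<close> \<subseteq> \<open>F K\<close> and forward invariance of \<open>Z\<close> enter,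
  so the lemma serves both for uniqueness of the tile and for showing that given points belong to
  it.\<close>

lemma attractor_absorbs:
  fixes L :: "'a::real_normed_vector \<Rightarrow> 'b::real_normed_vector"
  assumes L: "bounded_linear L" and Linv: "c > 0" "\<And>v. norm v \<le> c * norm (L v)"
    and \<rho>: "0 \<le> \<rho>" "\<rho> < 1"
    and contr: "\<And>i x y. i \<in> I \<Longrightarrow> norm (L (f i x - f i y)) \<le> \<rho> * norm (L (x - y))"
    and K: "bounded K" "K \<subseteq> (\<Union>i\<in>I. f i ` K)"
    and Z: "closed Z" "Z \<noteq> {}" "\<And>i x. i \<in> I \<Longrightarrow> x \<in> Z \<Longrightarrow> f i x \<in> Z"
  shows "K \<subseteq> Z"
proof
  fix x assume "x \<in> K"
  obtain z where z: "z \<in> Z" using Z(2) by blast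
  obtain C where C: "\<And>x. x \<in> K \<Longrightarrow> norm x \<le> C" using K(1) bounded_iff by metis
  obtain l where l: "\<And>x. norm (L x) \<le> norm x * l" "l > 0"
    using bounded_linear.pos_bounded[OF L] by blast
  have *: "\<exists>k\<in>Z. norm (L (x - k)) \<le> \<rho> ^ n * ((C + norm z) * l)" if "x \<in> K" for x n
    using that
  proof (induction n arbitrary: x)
    case 0
    have "norm (x - z) \<le> C + norm z" using C[OF 0] norm_triangle_ineq4[of x z] by linarith
    then have "norm (L (x - z)) \<le> (C + norm z) * l"
      using l(1)[of "x - z"] l(2) by (meson mult_right_mono order.trans less_imp_le)
    then show ?case using z by auto
  next
    case (Suc n)
    obtain i x' where i: "i \<in> I" "x' \<in> K" "x = f i x'" using K(2) Suc.prems by blast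
    obtain k where k: "k \<in> Z" "norm (L (x' - k)) \<le> \<rho> ^ n * ((C + norm z) * l)"
      using Suc.IH[OF i(2)] by blast
    have "norm (L (x - f i k)) \<le> \<rho> * norm (L (x' - k))" using contr i by simp
    also have "\<dots> \<le> \<rho> * (\<rho> ^ n * ((C + norm z) * l))" by (rule mult_left_mono[OF k(2) \<rho>(1)])
    finally show ?case using Z(3)[OF i(1) k(1)] by (intro bexI[of _ "f i k"]) (auto simp: mult.assoc)
  qed
  have "\<exists>k\<in>Z. dist k x < e" if "e > 0" for e
  proof -
    have "(\<lambda>n. c * (\<rho> ^ n * ((C + norm z) * l))) \<longlonglongrightarrow> c * (0 * ((C + norm z) * l))"
      by (intro tendsto_intros LIMSEQ_power_zero) (use \<rho> in auto)
    then have "eventually (\<lambda>n. c * (\<rho> ^ n * ((C + norm z) * l)) < e) sequentially"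
      using that by (intro order_tendstoD) auto
    then obtain n where n: "c * (\<rho> ^ n * ((C + norm z) * l)) < e"
      by (auto simp: eventually_sequentially)
    obtain k where k: "k \<in> Z" "norm (L (x - k)) \<le> \<rho> ^ n * ((C + norm z) * l)"
      using *[OF \<open>x \<in> K\<close>] by blast
    have "norm (x - k) \<le> c * norm (L (x - k))" by (rule Linv(2))
    also have "\<dots> \<le> c * (\<rho> ^ n * ((C + norm z) * l))" using k(2) Linv(1) by (intro mult_left_mono) auto
    finally have "dist k x < e" using n by (simp add: dist_norm norm_minus_commute)
    then show ?thesis using k(1) by blast
  qed
  then have "x \<in> closure Z" by (auto simp: closure_approachable)
  then show "x \<in> Z" using Z(1) by simp
qed

text \<open>As in Knaster-Tarski, \<open>T\<close> is the largest \<open>K\<close> \<subseteq>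
  \<open>R\<close> covered by its own images. Distances are measured through \<open>L\<close>,
  because contraction is assumed only there. Maximality makes \<open>T\<close> closed, and the fixed
  point \<open>z\<close> makes it nonempty.\<close>

lemma attractor_exists:
  fixes L :: "'a::euclidean_space \<Rightarrow> 'b::real_normed_vector"
  assumes L: "bounded_linear L" and Linv: "c > 0" "\<And>v. norm v \<le> c * norm (L v)"
    and \<rho>: "0 \<le> \<rho>" "\<rho> < 1"
    and I: "finite I" "i0 \<in> I" "f i0 z = z"
    and contr: "\<And>i x y. i \<in> I \<Longrightarrow> norm (L (f i x - f i y)) \<le> \<rho> * norm (L (x - y))"
  shows "\<exists>T. T \<noteq> {} \<and> compact T \<and> T = (\<Union>i\<in>I. f i ` T)"
proof -
  interpret L: bounded_linear L by (rule L)
  define C where "C = (\<Sum>i\<in>I. norm (L (f i z - z)))"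
  have C: "norm (L (f i z - z)) \<le> C" if "i \<in> I" for i
    unfolding C_def using that I(1) by (intro member_le_sum) auto
  have "C \<ge> 0" unfolding C_def by (intro sum_nonneg) auto
  \<comment> \<open>The radius solves \<rho> r + C = r, where \<open>C\<close> bounds how far the
    maps move the centre \<open>z\<close>; hence every map sends \<open>R\<close> into
    itself.\<close>
  define r where "r = C / (1 - \<rho>)"
  have r: "\<rho> * r + C = r" "r \<ge> 0" using \<rho> \<open>C \<ge> 0\<close> by (auto simp: r_def field_simps)
  define R where "R = {x. norm (L (x - z)) \<le> r}"
  have FR: "f i x \<in> R" if "i \<in> I" "x \<in> R" for i x
  proof -
    have "norm (L (f i x - z)) = norm (L (f i x - f i z) + L (f i z - z))"
      by (simp add: L.diff)
    also have "\<dots> \<le> norm (L (f i x - f i z)) + norm (L (f i z - z))" by (rule norm_triangle_ineq)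
    also have "\<dots> \<le> \<rho> * norm (L (x - z)) + C" using contr[OF that(1)] C[OF that(1)] by (intro add_mono)
    also have "\<dots> \<le> \<rho> * r + C" using that \<rho> by (auto simp: R_def intro: mult_left_mono)
    finally show ?thesis using r by (simp add: R_def)
  qed
  have "closed R" unfolding R_def
    by (intro closed_Collect_le continuous_intros L.continuous_on)
  have "bounded R"
  proof -
    have "norm (x - z) \<le> c * r" if "x \<in> R" for x
    proof -
      have "norm (x - z) \<le> c * norm (L (x - z))" by (rule Linv)
      also have "\<dots> \<le> c * r" using that Linv(1) by (simp add: R_def)
      finally show ?thesis .
    qed
    then have "R \<subseteq> cball z (c * r)" by (auto simp: dist_norm norm_minus_commute)
    then show ?thesis using bounded_cball bounded_subset by blast
  qed
  have cont: "continuous_on X (f i)" if "i \<in> I" for i X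
  proof -
    obtain l where l: "\<And>x. norm (L x) \<le> norm x * l" "l > 0" using L.pos_bounded by blast
    have "dist (f i x) (f i y) \<le> (c * \<rho> * l) * dist x y" for x y
    proof -
      have "norm (f i x - f i y) \<le> c * norm (L (f i x - f i y))" by (rule Linv)
      also have "\<dots> \<le> c * (\<rho> * (norm (x - y) * l))"
        using contr[OF that, of x y] l(1)[of "x - y"] \<rho>(1) Linv(1)
        by (intro mult_left_mono) (auto intro: order_trans mult_left_mono)
      finally show ?thesis by (simp add: dist_norm algebra_simps)
    qed
    then have "(c * \<rho> * l)-lipschitz_on X (f i)"
      using Linv(1) \<rho>(1) l(2) by (intro lipschitz_onI) auto
    then show ?thesis by (rule lipschitz_on_continuous_on)
  qed
  define F where "F X = (\<Union>i\<in>I. f i ` X)" for X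
  have Fmono: "F X \<subseteq> F Y" if "X \<subseteq> Y" for X Y using that by (auto simp: F_def)
  define T where "T = \<Union>{K. K \<subseteq> R \<and> K \<subseteq> F K}"
  have TR: "T \<subseteq> R" by (auto simp: T_def)
  have TF: "T \<subseteq> F T"
  proof
    fix x assume "x \<in> T"
    then obtain K where K: "K \<subseteq> R" "K \<subseteq> F K" "x \<in> K" by (auto simp: T_def)
    then have "K \<subseteq> T" by (auto simp: T_def)
    then show "x \<in> F T" using K Fmono by blast
  qed
  have "F T \<subseteq> R" using TR FR by (auto simp: F_def)
  then have FT: "F T \<subseteq> T" using Fmono[OF TF] by (auto simp: T_def)
  have cR: "closure T \<subseteq> R" using TR \<open>closed R\<close> by (simp add: closure_minimal)
  then have cc: "compact (closure T)"
    using \<open>bounded R\<close> bounded_subset compact_eq_bounded_closed closed_closure by blast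
  have "compact (F (closure T))" unfolding F_def
    using cc cont I(1) by (intro compact_UN compact_continuous_image) auto
  then have "closure T \<subseteq> F (closure T)"
    using TF Fmono[OF closure_subset] by (intro closure_minimal compact_imp_closed) blast+
  \<comment> \<open>The closure is itself covered by its images, so maximality of \<open>T\<close>
    absorbs it.\<close>
  then have "closure T \<subseteq> T" using cR unfolding T_def by blast
  then have "T = closure T" using closure_subset by blast
  then have "compact T" using cc by simp
  moreover have "z \<in> T"
    using I r unfolding T_def F_def R_def by (intro UnionI[of "{z}"]) (auto simp: L.zero intro!: bexI[of _ i0])
  ultimately show ?thesis using TF FT unfolding F_def by blast
qed

text \<open>Brouwer's theorem for \<open>h\<close>, which moves against the first component of
  \<open>F\<close> and along the second, then clamps to the square. The boundary signs push inwards,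
  so a fixed point cannot come from the clamping and must be a zero of \<open>F\<close>.\<close>

lemma poincare_miranda:
  fixes F :: "real \<times> real \<Rightarrow> real \<times> real"
  assumes cont: "continuous_on (cbox (0,0) (1,1)) F"
    and 1: "\<And>t. 0 \<le> t \<Longrightarrow> t \<le> 1 \<Longrightarrow> fst (F (0,t)) < 0" "\<And>t. 0 \<le> t \<Longrightarrow> t \<le> 1 \<Longrightarrow> fst (F (1,t)) > 0"
    and 2: "\<And>t. 0 \<le> t \<Longrightarrow> t \<le> 1 \<Longrightarrow> snd (F (t,0)) > 0" "\<And>t. 0 \<le> t \<Longrightarrow> t \<le> 1 \<Longrightarrow> snd (F (t,1)) < 0"
  shows "\<exists>x\<in>cbox (0,0) (1,1). F x = 0"
proof -
  define h where "h x = (max 0 (min 1 (fst x - fst (F x))), max 0 (min 1 (snd x + snd (F x))))" for x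
  have "continuous_on (cbox (0,0) (1,1)) h" unfolding h_def
    by (intro continuous_intros cont)
  moreover have "h \<in> cbox (0,0) (1,1) \<rightarrow> cbox (0,0) (1,1)" by (auto simp: h_def)
  moreover have "cbox (0,0) (1,1) \<noteq> ({}::(real\<times>real) set)" by (auto simp: cbox_Pair_eq)
  ultimately obtain x where x: "x \<in> cbox (0,0) (1,1)" "h x = x"
    using brouwer[of "cbox (0,0) (1,1)" h] compact_cbox convex_box by blast
  obtain a b where ab: "x = (a,b)" by (cases x)
  have "0 \<le> a" "a \<le> 1" "0 \<le> b" "b \<le> 1" using x(1) ab by (auto simp: cbox_Pair_eq)
  then have "fst (F (a,b)) = 0 \<and> snd (F (a,b)) = 0"
    using x(2) 1[of b] 2[of a] unfolding ab h_def
    by (cases "a = 0"; cases "a = 1"; cases "b = 0"; cases "b = 1") (auto simp: max_def min_def split: if_splits)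
  then show ?thesis using x(1) ab by (metis prod_eq_iff fst_zero snd_zero)
qed

text \<open>\<open>U\<close> is the image of the open ball, open by invariance of domain. Paths are
  images of straight segments: the Euclidean ball is strictly convex, so only the two ends of a
  segment can touch the sphere.\<close>

lemma disk_interior_structure:
  fixes T :: "(real \<times> real) set"
  assumes "disk_like T"
  obtains U where "open U" "U \<subseteq> T" "T \<subseteq> closure U"
    "\<And>p q. p \<in> T \<Longrightarrow> q \<in> T \<Longrightarrow> path_component (insert p (insert q U)) p q"
proof -
  obtain h k where hk: "homeomorphism (cball (0::real\<times>real) 1) T h k"
    using assms unfolding disk_like_def by (meson homeomorphic_sym homeomorphic_def)
  define U where "U = h ` ball 0 1"
  have cont: "continuous_on (cball 0 1) h" and im: "h ` cball 0 1 = T"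
    using hk by (auto simp: homeomorphism_def)
  have inj: "inj_on h (cball 0 1)"
    using homeomorphism_apply1[OF hk] by (rule inj_on_inverseI)
  have "open U" unfolding U_def
    by (rule invariance_of_domain) (auto intro: continuous_on_subset[OF cont] inj_on_subset[OF inj])
  moreover have "U \<subseteq> T" using im ball_subset_cball by (auto simp: U_def)
  moreover have "T \<subseteq> closure U"
  proof -
    have "h ` closure (ball 0 1) \<subseteq> closure U"
      by (rule image_closure_subset) (use cont closure_subset[of U] in \<open>auto simp: U_def\<close>)
    then show ?thesis using im by simp
  qed
  moreover have "path_component (insert p (insert q U)) p q" if pq: "p \<in> T" "q \<in> T" for p q
  proof -
    obtain x y where xy: "x \<in> cball 0 1" "y \<in> cball 0 1" "p = h x" "q = h y" using pq im by blast
    have seg: "closed_segment x y \<subseteq> cball 0 1"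
      using xy(1,2) by (intro closed_segment_subset) auto
    have "open_segment x y \<subseteq> ball 0 1"
    proof
      fix z assume "z \<in> open_segment x y"
      then have "dist 0 z < dist 0 x \<or> dist 0 z < dist 0 y" by (rule dist_decreases_open_segment)
      then show "z \<in> ball 0 1" using xy(1,2) by auto
    qed
    then have "h ` closed_segment x y \<subseteq> insert p (insert q U)"
      using xy by (auto simp: U_def closed_segment_eq_open)
    moreover have "path_connected (h ` closed_segment x y)"
      by (intro path_connected_continuous_image continuous_on_subset[OF cont seg]) 
         (simp add: convex_imp_path_connected)
    ultimately show ?thesis
      using xy by (meson ends_in_segment image_eqI path_component_of_subset path_connected_component)
  qed
  ultimately show thesis using that by blast
qed

subsection \<open>Lattice reachability and measure\<close>

text \<open>Predecessors are found by dividing with rounding towards zero.\<close>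

lemma int_pair_reach:
  fixes \<alpha> B :: int
  assumes \<alpha>: "3 \<le> \<alpha>" "\<alpha> \<le> B"
    and H0: "H 0 0"
    and step: "\<And>p q r. H p q \<Longrightarrow> \<bar>r - \<alpha> * q + B * p\<bar> \<le> B - 1 \<Longrightarrow> H q r"
  shows "H p q"
proof -
  have pos: "B > 0" using \<alpha> by linarith
  have md: "B * (x div B) = x - x mod B" "0 \<le> x mod B" "x mod B \<le> B - 1" for x
    using pos by (simp_all add: minus_mod_eq_mult_div [symmetric])
  have dle: "0 \<le> x div B \<and> B * (x div B) \<le> x" if "0 \<le> x" for x
    using md(1,2)[of x] pos_imp_zdiv_nonneg_iff[OF pos, of x] that by linarith
  have sgn: "\<bar>\<sigma> * z - \<alpha> * (\<sigma> * y) + B * (\<sigma> * x)\<bar> \<le> B - 1"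
    if "\<sigma> \<in> {1,-1}" "\<bar>z - \<alpha> * y + B * x\<bar> \<le> B - 1" for \<sigma> x y z
  proof -
    have "\<sigma> * z - \<alpha> * (\<sigma> * y) + B * (\<sigma> * x) = \<sigma> * (z - \<alpha> * y + B * x)" by (simp add: algebra_simps)
    then show ?thesis using that by (auto simp only: abs_mult insert_iff empty_iff abs_minus_cancel abs_one mult_1)
  qed
  have nonneg: "H (\<sigma> * b) (\<sigma> * a)"
    if "0 \<le> a" "0 \<le> b" "a \<le> int n" "b \<le> int n" "\<sigma> \<in> {1,-1}" for a b \<sigma> n
    using that
  proof (induction n arbitrary: a b \<sigma> rule: less_induct)
    case (less n)
    have st: "H (\<sigma> * y) (\<sigma> * z)" if "H (\<sigma> * x) (\<sigma> * y)" "\<bar>z - \<alpha> * y + B * x\<bar> \<le> B - 1" for x y z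
      using that less.prems(5) by (intro step[OF that(1)]) (rule sgn)
    \<comment> \<open>Inner induction on \<open>b\<close>. If a \<le> \<alpha> b, the predecessor of
      (b, a) is a nonnegative pair (c, b) with c < b.\<close>
    have main: "H (\<sigma> * b) (\<sigma> * a)" if "0 < a" "a \<le> int n" "0 \<le> b" "b \<le> int n" for a b
      using that
    proof (induction "nat b" arbitrary: a b rule: less_induct)
      case (less b a)
      note inner = less
      show ?case
      proof (cases "a \<le> \<alpha> * b")
        case True
        define c where "c = (\<alpha> * b - a) div B"
        have c: "0 \<le> c" "B * c \<le> \<alpha> * b - a" using dle[of "\<alpha> * b - a"] True by (auto simp: c_def)
        have "b > 0" using True inner(2,4) by (cases "b = 0") auto
        have "\<alpha> * b \<le> B * b" using \<alpha> inner(4) by (intro mult_right_mono) auto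
        then have "B * c < B * b" using c inner(2) by linarith
        then have "c < b" using pos by simp
        then have "H (\<sigma> * c) (\<sigma> * b)" using inner c \<open>b > 0\<close> by (intro inner(1)) auto
        moreover have "\<bar>a - \<alpha> * b + B * c\<bar> \<le> B - 1" using md[of "\<alpha> * b - a"] unfolding c_def by linarith
        ultimately show ?thesis by (rule st)
      next
        \<comment> \<open>Now one step back gives the mixed pair (-c, b), and a second one gives
          (-e, -c). Both entries have the same sign again and are smaller than \<open>a\<close> in
          absolute value, so the outer induction applies with the opposite \<sigma>.\<close>
        case False
        define c where "c = (a - \<alpha> * b) div B"
        define e where "e = (b + \<alpha> * c) div B"
        have ab: "0 \<le> a - \<alpha> * b" using False by simp
        have c: "0 \<le> c" "B * c \<le> a - \<alpha> * b" using dle[OF ab] by (auto simp: c_def)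
        have "0 \<le> \<alpha> * c" using c \<alpha> by simp
        then have e: "0 \<le> e" "B * e \<le> b + \<alpha> * c" using dle[of "b + \<alpha> * c"] inner(4) by (auto simp: e_def)
        have "3 * b \<le> \<alpha> * b" using \<alpha> inner(4) by (intro mult_right_mono) auto
        moreover have "\<alpha> * c \<le> B * c" using \<alpha> c by (intro mult_right_mono) auto
        ultimately have "B * c \<le> a" "B * e \<le> a" using c e inner(4) by linarith+
        moreover have "3 * c \<le> B * c" "3 * e \<le> B * e" using \<alpha> c e by (intro mult_right_mono; simp)+
        ultimately have "c < a" "e < a" using inner(2) c e by linarith+
        then have "H ((-\<sigma>) * e) ((-\<sigma>) * c)"
          using inner(2,3) c e \<open>\<sigma> \<in> {1,-1}\<close>
          by (intro less.IH[of "n - 1"]) (auto simp: of_nat_diff)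
        then have "H (\<sigma> * (-e)) (\<sigma> * (-c))" by simp
        moreover have "\<bar>b - \<alpha> * (-c) + B * (-e)\<bar> \<le> B - 1" using md[of "b + \<alpha> * c"] unfolding e_def mult_minus_right by linarith
        ultimately have "H (\<sigma> * (-c)) (\<sigma> * b)" by (rule st)
        moreover have "\<bar>a - \<alpha> * b + B * (-c)\<bar> \<le> B - 1" using md[of "a - \<alpha> * b"] unfolding c_def mult_minus_right by linarith
        ultimately show ?thesis by (rule st)
      qed
    qed
    show ?case
    proof (cases "a > 0")
      case True
      then show ?thesis using main less.prems by blast
    next
      case False
      then have "a = 0" using less.prems by simp
      show ?thesis
      proof (cases "b = 0")
        case True
        then show ?thesis using H0 \<open>a = 0\<close> by simp
      next
        case False
        \<comment> \<open>The predecessor (c, b) of (b, 0) has positive second entry, which is the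
          case treated by \<open>main\<close>.\<close>
        define c where "c = (\<alpha> * b) div B"
        have "b > 0" using False less.prems by simp
        then have ab: "0 \<le> \<alpha> * b" using \<alpha> by simp
        have c: "0 \<le> c" "B * c \<le> \<alpha> * b" using dle[OF ab] by (auto simp: c_def)
        have "\<alpha> * b \<le> B * b" using \<alpha> \<open>b > 0\<close> by (intro mult_right_mono) auto
        then have "B * c \<le> B * b" using c by linarith
        then have "c \<le> b" using pos by simp
        then have "H (\<sigma> * c) (\<sigma> * b)" using main c \<open>b > 0\<close> less.prems by auto
        moreover have "\<bar>a - \<alpha> * b + B * c\<bar> \<le> B - 1" using md[of "\<alpha> * b"] \<open>a = 0\<close> unfolding c_def by linarith
        ultimately show ?thesis by (rule st)
      qed
    qed
  qed
  have same: "H (\<sigma> * b) (\<sigma> * a)" if "0 \<le> a" "0 \<le> b" "\<sigma> \<in> {1,-1}" for a b \<sigma>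
    using that by (intro nonneg[of a b "nat (max a b)"]) auto
  have opp: "H (\<sigma> * b) (\<sigma> * (-a))" if "0 \<le> a" "0 \<le> b" "\<sigma> \<in> {1,-1}" for a b \<sigma>
  proof -
    \<comment> \<open>A pair (b, -a) of mixed signs has the nonnegative predecessor (c, b).\<close>
    define c where "c = (\<alpha> * b + a) div B"
    have ab: "0 \<le> \<alpha> * b + a" using \<alpha> that by simp
    have "H (\<sigma> * c) (\<sigma> * b)" using dle[OF ab] that by (intro same) (auto simp: c_def)
    moreover have "\<bar>(-a) - \<alpha> * b + B * c\<bar> \<le> B - 1" using md[of "\<alpha> * b + a"] unfolding c_def by linarith
    ultimately show ?thesis using step sgn[OF that(3)] by blast
  qed
  consider "p \<ge> 0" "q \<ge> 0" | "p \<ge> 0" "q \<le> 0" | "p \<le> 0" "q \<ge> 0" | "p \<le> 0" "q \<le> 0" by linarith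
  then show ?thesis
  proof cases
    case 1 then show ?thesis using same[of q p 1] by simp
  next
    case 2 then show ?thesis using opp[of "-q" p 1] by simp
  next
    case 3 then show ?thesis using opp[of q "-p" "-1"] by simp
  next
    case 4 then show ?thesis using same[of "-q" "-p" "-1"] by simp
  qed
qed

text \<open>Fubini: for fixed \<open>y\<close> the shear is a translation in \<open>x\<close> and
  preserves the inner integral, and the substitution of -\<beta> y in the outer integral contributes
  the factor \<beta>.\<close>

lemma emeasure_companion_image:
  fixes \<beta> \<gamma> :: real and E :: "(real \<times> real) set"
  defines "M \<equiv> \<lambda>p. (- \<beta> * snd p, fst p - \<gamma> * snd p)"
  assumes \<beta>: "\<beta> > 0" and E: "compact E"
  shows "emeasure lborel (M ` E) = ennreal \<beta> * emeasure lborel E"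
proof -
  have "continuous_on UNIV M" unfolding M_def by (intro continuous_intros)
  then have "compact (M ` E)" using E compact_continuous_image continuous_on_subset by blast
  then have ME[measurable]: "M ` E \<in> sets borel" by (simp add: borel_compact)
  have [measurable]: "E \<in> sets borel" using E by (simp add: borel_compact)
  have "inj M" using \<beta> by (auto simp: inj_on_def M_def prod_eq_iff)
  then have ind: "indicator E p = (indicator (M ` E) (M p) :: ennreal)" for p
    by (auto simp: indicator_def inj_image_mem_iff)
  let ?i = "indicator (M ` E) :: real \<times> real \<Rightarrow> ennreal"
  have [measurable]: "?i \<in> borel_measurable borel" by simp
  have im[measurable]: "?i \<in> borel_measurable (borel \<Otimes>\<^sub>M borel)" by (simp add: borel_prod)
  have "emeasure lborel E = (\<integral>\<^sup>+p. indicator E p \<partial>lborel)" by simp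
  also have "\<dots> = (\<integral>\<^sup>+p. ?i (- \<beta> * snd p, fst p - \<gamma> * snd p) \<partial>(lborel \<Otimes>\<^sub>M lborel))"
    by (simp add: ind lborel_prod M_def)
  also have "\<dots> = (\<integral>\<^sup>+y. \<integral>\<^sup>+x. ?i (- \<beta> * y, x - \<gamma> * y) \<partial>lborel \<partial>lborel)"
    by (subst lborel_pair.nn_integral_snd[symmetric]) auto
  also have "\<dots> = (\<integral>\<^sup>+y. \<integral>\<^sup>+x. ?i (- \<beta> * y, x) \<partial>lborel \<partial>lborel)"
  proof (rule nn_integral_cong)
    fix y
    show "(\<integral>\<^sup>+x. ?i (- \<beta> * y, x - \<gamma> * y) \<partial>lborel) = (\<integral>\<^sup>+x. ?i (- \<beta> * y, x) \<partial>lborel)"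
      using nn_integral_real_affine[of "\<lambda>x. ?i (- \<beta> * y, x)" 1 "- \<gamma> * y"] by simp
  qed
  finally have 1: "emeasure lborel E = (\<integral>\<^sup>+y. \<integral>\<^sup>+x. ?i (- \<beta> * y, x) \<partial>lborel \<partial>lborel)" .
  have "emeasure lborel (M ` E) = (\<integral>\<^sup>+p. ?i p \<partial>(lborel \<Otimes>\<^sub>M lborel))" by (simp add: lborel_prod)
  also have "\<dots> = (\<integral>\<^sup>+y. \<integral>\<^sup>+x. ?i (y, x) \<partial>lborel \<partial>lborel)"
    by (subst lborel.nn_integral_fst[symmetric]) auto
  also have "\<dots> = ennreal \<bar>-\<beta>\<bar> * (\<integral>\<^sup>+y. \<integral>\<^sup>+x. ?i (0 + - \<beta> * y, x) \<partial>lborel \<partial>lborel)"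
    using \<beta> by (subst nn_integral_real_affine[of _ "-\<beta>" 0]) auto
  finally show ?thesis using 1 \<beta> by simp
qed

text \<open>Replacing \<open>E j\<close> by \<open>E j - E i\<close> leaves the union unchanged but
  lowers the subadditive bound by the measure of the intersection.\<close>

lemma null_Int_of_additive_Union:
  assumes I: "finite I" "i \<in> I" "j \<in> I" "i \<noteq> j"
    and E: "\<And>k. k \<in> I \<Longrightarrow> E k \<in> fmeasurable M"
    and eq: "measure M (\<Union>k\<in>I. E k) = (\<Sum>k\<in>I. measure M (E k))"
  shows "measure M (E i \<inter> E j) = 0"
proof -
  have sub: "(\<Union>k\<in>I. E k) = (\<Union>k\<in>I - {j}. E k) \<union> (E j - E i)" using I by auto
  have "measure M (\<Union>k\<in>I. E k) \<le> measure M (\<Union>k\<in>I - {j}. E k) + measure M (E j - E i)"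
    unfolding sub using I E by (intro measure_Un_le fmeasurableD sets.finite_UN) auto
  also have "measure M (\<Union>k\<in>I - {j}. E k) \<le> (\<Sum>k\<in>I - {j}. measure M (E k))"
    using I E by (intro measure_UNION_le) auto
  also have "measure M (E j - E i) = measure M (E j) - measure M (E j \<inter> E i)"
  proof -
    have "E j - E i = E j - (E j \<inter> E i)" by auto
    then show ?thesis using I E
      by (simp add: measurable_measure_Diff fmeasurable.Int fmeasurableD)
  qed
  finally show ?thesis using eq sum.remove[OF I(1,3), of "\<lambda>k. measure M (E k)"]
    by (simp add: Int_commute measure_nonneg antisym)
qed

text \<open>The inverse companion matrix contracts a quadratic form: the Lyapunov form
  \<open>(1 + b') (w\<^sub>1\<^sup>2 + w\<^sub>0\<^sup>2) + 2 a' w\<^sub>0 w\<^sub>1\<close> of the recurrence \<open>w\<^sub>2 + a' w\<^sub>1 + b' w\<^sub>0 = 0\<close> drops by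
  \<open>(1 - b') (w\<^sub>2 - w\<^sub>0)\<^sup>2\<close>. Scaling the matrix by \<open>l = 1 + 1/b\<close> first turns this into a strict contraction.\<close>

lemma companion_inverse_contraction:
  fixes a b :: real
  assumes ab: "\<bar>a\<bar> \<le> b" "b \<ge> 3"
  obtains L :: "real \<times> real \<Rightarrow> real \<times> real" and c \<rho> :: real
  where "bounded_linear L" "c > 0" "\<And>v. norm v \<le> c * norm (L v)" "0 \<le> \<rho>" "\<rho> < 1"
    "\<And>v. norm (L (snd v - a / b * fst v, - fst v / b)) \<le> \<rho> * norm (L v)"
proof -
  define l where "l = 1 + 1 / b"
  define a' where "a' = l * a / b"
  define b' where "b' = l\<^sup>2 / b"
  define \<mu> where "\<mu> = (1 + b' - a') / 2"
  define \<nu> where "\<nu> = (1 + b' + a') / 2"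
  \<comment> \<open>Rescaling the second coordinate by \<open>k\<close> brings \<open>l\<close>
    times the matrix to companion form, sending (x, Y) to (X, -x) with \<open>X\<close> and
    \<open>Y\<close> as below.\<close>
  define k where "k = b / l"
  have b: "b > 0" and l: "l > 1" "l \<le> 4 / 3" using ab by (auto simp: l_def field_simps)
  have "\<bar>a'\<bar> = l * (\<bar>a\<bar> / b)" using b l by (simp add: a'_def abs_mult)
  also have "\<dots> \<le> l * 1" using ab b l by (intro mult_left_mono) auto
  \<comment> \<open>With l = 1 + 1/b this reads 1/b < l^2/b. It makes the quadratic form positive
    definite, that is, \<mu> and \<nu> positive.\<close>
  also have "l * 1 < 1 + b'"
  proof -
    have "1 < l\<^sup>2" using l by (simp add: one_less_power)
    then have "1 / b < b'" using b by (simp add: b'_def divide_strict_right_mono)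
    then show ?thesis by (simp add: l_def)
  qed
  finally have a': "\<bar>a'\<bar> < 1 + b'" .
  then have pos: "\<mu> > 0" "\<nu> > 0" by (auto simp: \<mu>_def \<nu>_def)
  have "l\<^sup>2 \<le> (4 / 3)\<^sup>2" using l by (intro power_mono) auto
  then have b': "b' < 1" using ab b by (simp add: b'_def power2_eq_square)
  define L where "L v = (sqrt \<mu> * (fst v + k * snd v), sqrt \<nu> * (fst v - k * snd v))" for v :: "real \<times> real"
  have lin: "linear L"
    unfolding L_def by (intro linearI) (auto simp: algebra_simps)
  then have bl: "bounded_linear L" by (simp add: linear_conv_bounded_linear)
  have k: "k > 0" using b l by (simp add: k_def)
  have "inj L"
  proof (rule linear_injective_0[OF lin, THEN iffD2], intro allI impI)
    fix v assume "L v = 0"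
    then have "fst v + k * snd v = 0" "fst v - k * snd v = 0"
      using pos by (auto simp: L_def zero_prod_def)
    then have "fst v = 0" "k * snd v = 0" by linarith+
    then show "v = 0" using k by (auto simp: prod_eq_iff)
  qed
  then obtain e where e: "e > 0" "\<And>x. e * norm x \<le> norm (L x)"
    using linear_inj_bounded_below_pos[OF lin] by blast
  have nL: "(norm (L v))\<^sup>2 = \<mu> * (fst v + k * snd v)\<^sup>2 + \<nu> * (fst v - k * snd v)\<^sup>2" for v
    using pos by (simp add: L_def norm_Pair power_mult_distrib)
  have "norm (L (snd v - a / b * fst v, - fst v / b)) \<le> (1 / l) * norm (L v)" for v
  proof -
    obtain x y where v: "v = (x, y)" by (cases v)
    define Y where "Y = k * y"
    \<comment> \<open>In the recurrence, \<open>-Y\<close>, \<open>x\<close>, \<open>X\<close> play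
      the roles of \<open>w\<^sub>0\<close>, \<open>w\<^sub>1\<close>, \<open>w\<^sub>2\<close>. The
      squared norm of \<open>L\<close> is the Lyapunov form, diagonalized by the sum and difference
      of the two coordinates.\<close>
    define X where "X = b' * Y - a' * x"
    have X: "X = l * (y - a / b * x)"
      using b l by (simp add: X_def Y_def k_def a'_def b'_def field_simps power2_eq_square)
    have Y': "l * (k * (- x / b)) = - x" using b l by (simp add: k_def)
    have e1: "l * (y - a / b * x + k * (- x / b)) = X - x"
      unfolding distrib_left X[symmetric] Y' by simp
    have e2: "l * (y - a / b * x - k * (- x / b)) = X + x"
      unfolding right_diff_distrib[of l "y - a / b * x"] X[symmetric] Y' by simp
    have "(l * norm (L (y - a / b * x, - x / b)))\<^sup>2
        = \<mu> * (l * (y - a / b * x + k * (- x / b)))\<^sup>2 + \<nu> * (l * (y - a / b * x - k * (- x / b)))\<^sup>2"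
      unfolding power_mult_distrib nL fst_conv snd_conv by (simp only: distrib_left mult.left_commute)
    also have "\<dots> = \<mu> * (X - x)\<^sup>2 + \<nu> * (X + x)\<^sup>2" unfolding e1 e2 ..
    also have "\<dots> = \<mu> * (x + Y)\<^sup>2 + \<nu> * (x - Y)\<^sup>2 - (1 - b') * (X + Y)\<^sup>2"
      unfolding \<mu>_def \<nu>_def X_def by (simp add: field_simps power2_eq_square)
    also have "\<dots> \<le> (norm (L v))\<^sup>2" using b' by (simp add: nL v Y_def)
    finally have "l * norm (L (y - a / b * x, - x / b)) \<le> norm (L v)"
      by (rule power2_le_imp_le) simp
    then show ?thesis using l v by (simp add: field_simps)
  qed
  moreover have "norm v \<le> (1 / e) * norm (L v)" for v using e by (simp add: field_simps)
  ultimately show thesis using that[of L "1 / e" "1 / l"] bl e l by simp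
qed

subsection \<open>The tile and its symmetrization\<close>

locale p2_tile =
  fixes A B :: int
  assumes A_le: "\<bar>A\<bar> \<le> B" and A_ge: "2 * \<bar>A\<bar> \<ge> B + 3"
begin

lemma B_ge_3: "B \<ge> 3" and abs_A_ge_3: "\<bar>A\<bar> \<ge> 3"
  using A_le A_ge by linarith+

definition M :: "real \<times> real \<Rightarrow> real \<times> real" where
  "M p = (- real_of_int B * snd p, fst p - real_of_int A * snd p)"

text \<open>The translation part of \<open>g\<close>. Subtracting it centres the digits: the numbers
  k - h with 0 \<le> k \<le> B - 1 are symmetric about 0.\<close>

definition h :: real where "h = (real_of_int B - 1) / 2"

text \<open>Inverse branch with digit \<open>d\<close>: the solution \<open>y\<close> of M y = x +
  (d, 0).\<close>

definition f :: "real \<Rightarrow> real \<times> real \<Rightarrow> real \<times> real" where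
  "f d p = (snd p - A / B * (fst p + d), - (fst p + d) / B)"

abbreviation T where "T \<equiv> tile A B"

definition S where "S = T \<union> uminus ` T"

lemma f_eq_iff: "f d x = y \<longleftrightarrow> M y = x + (d, 0)"
proof -
  have B: "real_of_int B \<noteq> 0" using B_ge_3 by simp
  have *: "e = - (a + d) / B \<longleftrightarrow> - real_of_int B * e = a + d" for a e :: real
    using B by (auto simp: field_simps)
  have "f d (a, b) = (c, e) \<longleftrightarrow> M (c, e) = (a, b) + (d, 0)" for a b c e
  proof -
    have "f d (a, b) = (c, e) \<longleftrightarrow> e = - (a + d) / B \<and> c = b - A * ((a + d) / B)"
      by (auto simp: f_def)
    also have "\<dots> \<longleftrightarrow> e = - (a + d) / B \<and> c - A * e = b" unfolding minus_divide_left[symmetric] by auto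
    also have "\<dots> \<longleftrightarrow> M (c, e) = (a, b) + (d, 0)" unfolding * by (simp add: M_def)
    finally show ?thesis .
  qed
  then show ?thesis by (metis surj_pair)
qed

lemma M_f [simp]: "M (f d x) = x + (d, 0)"
  using f_eq_iff by blast

lemma inj_f: "inj_on (f d) X"
  by (metis M_f add_right_cancel inj_onI)

lemma f_minus: "f (- d) (- x) = - f d x"
proof -
  have "M (- f d x) = - M (f d x)" by (simp add: M_def)
  then show ?thesis unfolding f_eq_iff by (simp add: prod_eq_iff)
qed

lemma f_diff: "f d x - f d y = (snd (x - y) - A / B * fst (x - y), - fst (x - y) / B)"
  by (auto simp: f_def field_simps diff_divide_distrib add_divide_distrib)

lemma contraction:
  obtains L :: "real \<times> real \<Rightarrow> real \<times> real" and c \<rho> :: real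
  where "bounded_linear L" "c > 0" "\<And>v. norm v \<le> c * norm (L v)" "0 \<le> \<rho>" "\<rho> < 1"
    "\<And>d x y. norm (L (f d x - f d y)) \<le> \<rho> * norm (L (x - y))"
proof -
  have "\<bar>real_of_int A\<bar> \<le> real_of_int B" "real_of_int B \<ge> 3" using A_le B_ge_3 by linarith+
  then obtain L :: "real \<times> real \<Rightarrow> real \<times> real" and c \<rho>
    where L: "bounded_linear L" "c > 0" "\<And>v. norm v \<le> c * norm (L v)" "0 \<le> \<rho>" "\<rho> < 1"
      "\<And>v. norm (L (snd v - A / B * fst v, - fst v / B)) \<le> \<rho> * norm (L v)"
    using companion_inverse_contraction by metis
  show thesis using that[OF L(1-5)] L(6) by (simp only: f_diff)
qed

text \<open>The inverse of \<open>g\<close> is \<open>f (- h)\<close>, so the equation for the tile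
  becomes the fixed-point equation of an iterated function system.\<close>

lemma tile_g_image_iff:
  "tile_g A B ` X = (\<Union>\<delta>\<in>tile_digits B. \<delta> ` X) \<longleftrightarrow> X = (\<Union>\<delta>\<in>tile_digits B. (\<lambda>x. f (- h) (\<delta> x)) ` X)"
proof -
  have g: "tile_g A B y = x \<longleftrightarrow> y = f (- h) x" for x y
  proof -
    have "tile_g A B y = M y + (h, 0)" by (simp add: tile_g_def M_def h_def)
    then show ?thesis using f_eq_iff[of "-h" x y] by (cases x; cases "M y") auto
  qed
  have "x \<in> tile_g A B ` X \<longleftrightarrow> f (- h) x \<in> X" for x using g by (metis imageE imageI)
  moreover have "y \<in> (\<Union>\<delta>\<in>tile_digits B. (\<lambda>x. f (- h) (\<delta> x)) ` X)
      \<longleftrightarrow> tile_g A B y \<in> (\<Union>\<delta>\<in>tile_digits B. \<delta> ` X)" for y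
  proof -
    have "y \<in> (\<Union>\<delta>\<in>tile_digits B. (\<lambda>x. f (- h) (\<delta> x)) ` X)
      \<longleftrightarrow> (\<exists>\<delta>\<in>tile_digits B. \<exists>x\<in>X. y = f (- h) (\<delta> x))" by auto
    also have "\<dots> \<longleftrightarrow> (\<exists>\<delta>\<in>tile_digits B. \<exists>x\<in>X. tile_g A B y = \<delta> x)" by (simp add: g)
    finally show ?thesis by auto
  qed
  moreover have "f (- h) (tile_g A B y) = y" "tile_g A B (f (- h) y) = y" for y using g by metis+
  ultimately show ?thesis unfolding set_eq_iff by metis
qed

lemma tile_a_power: "(tile_a ^^ k) p = p + (real k, 0)"
  by (induction k) (auto simp: tile_a_def prod_eq_iff)

lemma tile_c_eq: "tile_c p = - p"
  by (simp add: tile_c_def prod_eq_iff)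

lemma tile_exists_unique: "\<exists>!X. X \<noteq> {} \<and> compact X \<and> tile_g A B ` X = (\<Union>\<delta>\<in>tile_digits B. \<delta> ` X)"
proof -
  obtain L :: "real \<times> real \<Rightarrow> real \<times> real" and c \<rho>
    where L: "bounded_linear L" "c > 0" "\<And>v. norm v \<le> c * norm (L v)" "0 \<le> \<rho>" "\<rho> < 1"
      "\<And>d x y. norm (L (f d x - f d y)) \<le> \<rho> * norm (L (x - y))" by (rule contraction) (rule that)
  interpret L: bounded_linear L by (rule L)
  have contr: "norm (L (f (- h) (\<delta> x) - f (- h) (\<delta> y))) \<le> \<rho> * norm (L (x - y))"
    if "\<delta> \<in> tile_digits B" for \<delta> x y
  proof -
    \<comment> \<open>Translations and the point reflection change differences by at most a sign,
      which a linear \<open>L\<close> does not notice in norm.\<close>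
    have "\<delta> x - \<delta> y = x - y \<or> \<delta> x - \<delta> y = - (x - y)"
      using that by (auto simp: tile_digits_def tile_a_power tile_c_eq)
    then have "norm (L (\<delta> x - \<delta> y)) = norm (L (x - y))" by (auto simp: L.neg simp del: minus_diff_eq)
    then show ?thesis using L(6)[of "- h" "\<delta> x" "\<delta> y"] by simp
  qed
  \<comment> \<open>\<open>z\<close> solves M z = z - (h, 0), so it is the fixed point belonging to
    the digit \<open>id\<close>; the denominator is positive because |A| \<le> B.\<close>
  define y where "y = h / (A + B + 1)"
  define z where "z = ((A + 1) * y, y)"
  have "id \<in> tile_digits B" unfolding tile_digits_def by (intro UnI1 image_eqI[of _ _ 0]) auto
  moreover have "f (- h) (id z) = z"
  proof -
    have "real_of_int (A + B + 1) > 0" using A_le by linarith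
    then have "(A + B + 1) * y = h" by (simp add: y_def)
    then show ?thesis unfolding f_eq_iff id_def by (simp add: M_def z_def algebra_simps)
  qed
  moreover have "finite (tile_digits B)" by (simp add: tile_digits_def)
  ultimately have ex: "\<exists>X. X \<noteq> {} \<and> compact X \<and> X = (\<Union>\<delta>\<in>tile_digits B. (\<lambda>x. f (- h) (\<delta> x)) ` X)"
    by (intro attractor_exists[OF L(1-5), where f = "\<lambda>\<delta> x. f (- h) (\<delta> x)"] contr)
  have sub: "X \<subseteq> Y"
    if "X \<noteq> {} \<and> compact X \<and> X = (\<Union>\<delta>\<in>tile_digits B. (\<lambda>x. f (- h) (\<delta> x)) ` X)"
      "Y \<noteq> {} \<and> compact Y \<and> Y = (\<Union>\<delta>\<in>tile_digits B. (\<lambda>x. f (- h) (\<delta> x)) ` Y)" for X Y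
  proof (rule attractor_absorbs[OF L(1-5) contr, where I = "tile_digits B"])
    show "X \<subseteq> (\<Union>\<delta>\<in>tile_digits B. (\<lambda>x. f (- h) (\<delta> x)) ` X)"
      by (rule equalityD1) (use that(1) in blast)
    show "f (- h) (\<delta> x) \<in> Y" if "\<delta> \<in> tile_digits B" "x \<in> Y" for \<delta> x
    proof (rule subsetD)
      show "(\<Union>\<delta>\<in>tile_digits B. (\<lambda>x. f (- h) (\<delta> x)) ` Y) \<subseteq> Y"
        by (rule equalityD2) (use \<open>Y \<noteq> {} \<and> _\<close> in blast)
    qed (use that in blast)
    show "bounded X" "closed Y" "Y \<noteq> {}" using that compact_imp_bounded compact_imp_closed by blast+
  qed
  show ?thesis unfolding tile_g_image_iff
    by (rule ex_ex1I[OF ex], rule subset_antisym) (rule sub, assumption+)+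
qed

lemma tile_nonempty: "T \<noteq> {}" and compact_tile: "compact T"
  and tile_image_eq: "tile_g A B ` T = (\<Union>\<delta>\<in>tile_digits B. \<delta> ` T)"
  using theI'[OF tile_exists_unique] unfolding tile_def by blast+

lemma f_shift: "f d (x + (k, 0)) = f (k + d) x"
  by (simp add: f_def algebra_simps)

lemma tile_fI:
  assumes "y \<in> T" shows "0 \<le> k \<Longrightarrow> k \<le> B - 2 \<Longrightarrow> f (k - h) y \<in> T" "f (- h) (- y) \<in> T"
proof -
  have *: "f (- h) (\<delta> y) \<in> T" if "\<delta> \<in> tile_digits B" for \<delta>
    using tile_image_eq[unfolded tile_g_image_iff] that assms by blast
  show "f (k - h) y \<in> T" if "0 \<le> k" "k \<le> B - 2"
  proof -
    have "tile_a ^^ nat k \<in> tile_digits B"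
      unfolding tile_digits_def using that by (intro UnI1 imageI) auto
    then have "f (- h) (y + (real (nat k), 0)) \<in> T" using * tile_a_power by metis
    then show ?thesis using that by (simp add: f_shift)
  qed
  have "tile_c \<in> tile_digits B" by (simp add: tile_digits_def)
  then show "f (- h) (- y) \<in> T" using * tile_c_eq by metis
qed

lemma tile_fD:
  assumes "x \<in> T"
  shows "(\<exists>k y. 0 \<le> k \<and> k \<le> B - 2 \<and> y \<in> T \<and> x = f (real_of_int k - h) y) \<or> (\<exists>y\<in>T. x = f (- h) (- y))"
proof -
  have "x \<in> (\<Union>\<delta>\<in>tile_digits B. (\<lambda>x. f (- h) (\<delta> x)) ` T)"
    by (rule subsetD[OF equalityD1[OF tile_image_eq[unfolded tile_g_image_iff]] assms])
  then obtain \<delta> y where \<delta>: "\<delta> \<in> tile_digits B" "y \<in> T" "x = f (- h) (\<delta> y)" by blast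
  show ?thesis
  proof (cases "\<delta> = tile_c")
    case True
    then show ?thesis using \<delta>(2,3) by (auto simp only: tile_c_eq)
  next
    case False
    then obtain n where n: "n \<le> nat B - 2" "\<delta> = tile_a ^^ n" using \<delta>(1) by (auto simp: tile_digits_def)
    then have "x = f (real_of_int (int n) - h) y" using \<delta>(3) by (simp add: tile_a_power f_shift)
    moreover have "int n \<le> B - 2" using n(1) B_ge_3 by linarith
    ultimately show ?thesis using \<delta>(2) by (intro disjI1 exI[of _ "int n"] exI[of _ y]) simp
  qed
qed

lemma S_iff: "x \<in> S \<longleftrightarrow> x \<in> T \<or> - x \<in> T"
proof -
  have "x \<in> uminus ` T \<longleftrightarrow> - x \<in> T" by (rule iffI) (clarsimp, rule image_eqI[of _ _ "- x"], simp_all)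
  then show ?thesis by (simp add: S_def)
qed

lemma minus_S [simp]: "- x \<in> S \<longleftrightarrow> x \<in> S"
  by (simp add: S_iff disj_commute)

lemma compact_S: "compact S"
  unfolding S_def using compact_tile by (intro compact_Un compact_continuous_image continuous_intros)

lemma h_reflect: "real_of_int (B - 1 - k) - h = - (real_of_int k - h)"
  by (simp add: h_def field_simps)

lemma S_cases:
  assumes "x \<in> S" obtains "x \<in> T" | "- x \<in> T"
  using assms S_iff by blast

lemma S_I: "x \<in> T \<Longrightarrow> x \<in> S" "- x \<in> T \<Longrightarrow> x \<in> S"
  by (simp_all add: S_iff)

text \<open>Digit 0 is attached to both \<open>id\<close> and \<open>tile_c\<close>, so it maps
  \<open>T\<close> and \<open>-T\<close> alike into \<open>T\<close>.\<close>

lemma f_S_in_tile: assumes "y \<in> S" shows "f (- h) y \<in> T"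
  using assms
proof (cases rule: S_cases)
  case 1
  then show ?thesis using tile_fI(1)[OF 1, of 0] B_ge_3 by simp
next
  case 2
  then show ?thesis using tile_fI(2)[of "- y"] by simp
qed

lemma f_S_in_neg_tile: assumes "y \<in> S" shows "- f h y \<in> T"
  using f_S_in_tile[of "- y"] assms unfolding f_minus by simp

lemma neg_tile_fI:
  assumes "- y \<in> T" "1 \<le> k" "k \<le> B - 1" shows "- f (k - h) y \<in> T"
proof -
  have "0 \<le> B - 1 - k" "B - 1 - k \<le> B - 2" using assms by linarith+
  from tile_fI(1)[OF assms(1) this] show ?thesis unfolding h_reflect f_minus .
qed

text \<open>Symmetrizing turns the reflection into an ordinary last digit. Digits 1 to B - 2
  preserve \<open>T\<close> and \<open>-T\<close> separately, digit 0 sends all of \<open>S\<close>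
  into \<open>T\<close>, and by reflection digit B - 1 sends all of \<open>S\<close> into
  \<open>-T\<close>.\<close>

lemma S_fI:
  assumes "y \<in> S" "0 \<le> k" "k \<le> B - 1" shows "f (k - h) y \<in> S"
proof -
  have "k = 0 \<or> k = B - 1 \<or> 1 \<le> k \<and> k \<le> B - 2" using assms by linarith
  then show ?thesis
  proof (elim disjE conjE)
    assume "k = 0"
    then show ?thesis using S_I(1)[OF f_S_in_tile[OF assms(1)]] by simp
  next
    assume "k = B - 1"
    then have "real_of_int k - h = h" by (simp add: h_def field_simps)
    then show ?thesis using S_I(2)[OF f_S_in_neg_tile[OF assms(1)]] by simp
  next
    assume k: "1 \<le> k" "k \<le> B - 2"
    from assms(1) show ?thesis
    proof (cases rule: S_cases)
      case 1
      show ?thesis by (rule S_I(1), rule tile_fI(1)[OF 1]) (use k in linarith)+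
    next
      case 2
      show ?thesis by (rule S_I(2), rule neg_tile_fI[OF 2]) (use k in linarith)+
    qed
  qed
qed

lemma S_fD:
  assumes "x \<in> S"
  shows "\<exists>k y. 0 \<le> k \<and> k \<le> B - 1 \<and> y \<in> S \<and> x = f (real_of_int k - h) y"
proof -
  have *: "\<exists>k y. 0 \<le> k \<and> k \<le> B - 1 \<and> y \<in> S \<and> x = f (real_of_int k - h) y" if "x \<in> T" for x
  proof -
    from tile_fD[OF that] show ?thesis
    proof (elim disjE exE conjE bexE)
      fix k y assume "0 \<le> k" "k \<le> B - 2" "y \<in> T" "x = f (real_of_int k - h) y"
      then show ?thesis by (intro exI[of _ k] exI[of _ y]) (auto simp: S_iff)
    next
      fix y assume "y \<in> T" "x = f (- h) (- y)"
      then show ?thesis using B_ge_3 by (intro exI[of _ 0] exI[of _ "- y"]) (auto simp: S_iff)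
    qed
  qed
  show ?thesis
  proof (cases "x \<in> T")
    case False
    then have "- x \<in> T" using assms False by (simp add: S_iff)
    then obtain k y where k: "0 \<le> k" "k \<le> B - 1" "y \<in> S" "- x = f (real_of_int k - h) y" using * by blast
    have "f (real_of_int (B - 1 - k) - h) (- y) = - (- x)"
      unfolding k(4) h_reflect f_minus ..
    then have "x = f (real_of_int (B - 1 - k) - h) (- y)" by simp
    then show ?thesis using k(1-3) by (intro exI[of _ "B - 1 - k"] exI[of _ "- y"]) (simp del: of_int_diff)
  qed (use * in blast)
qed

lemma invariant_subset:
  assumes K: "bounded K" "\<And>x. x \<in> K \<Longrightarrow> \<exists>k\<in>J. \<exists>y\<in>K. x = f (real_of_int k - h) y"
    and Z: "closed Z" "Z \<noteq> {}" "\<And>k x. k \<in> J \<Longrightarrow> x \<in> Z \<Longrightarrow> f (real_of_int k - h) x \<in> Z"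
  shows "K \<subseteq> Z"
proof -
  obtain L :: "real \<times> real \<Rightarrow> real \<times> real" and c \<rho>
    where L: "bounded_linear L" "c > 0" "\<And>v. norm v \<le> c * norm (L v)" "0 \<le> \<rho>" "\<rho> < 1"
      "\<And>d x y. norm (L (f d x - f d y)) \<le> \<rho> * norm (L (x - y))" by (rule contraction) (rule that)
  show ?thesis
  proof (rule attractor_absorbs[OF L(1-5), where f = "\<lambda>k. f (real_of_int k - h)" and I = J])
    show "K \<subseteq> (\<Union>k\<in>J. f (real_of_int k - h) ` K)" using K(2) by fast
  qed (rule L(6) K(1) Z; assumption?)+
qed

lemma S_nonempty: "S \<noteq> {}" using tile_nonempty S_I(1) by blast

text \<open>A membership test for \<open>S\<close>: points whose digit expansions never leave a
  bounded set. Applied to finite \<open>K\<close> it certifies points with periodic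
  expansions.\<close>

lemma subset_S:
  assumes "bounded K" "\<And>x. x \<in> K \<Longrightarrow> \<exists>k y. 0 \<le> k \<and> k \<le> B - 1 \<and> y \<in> K \<and> M x = y + (real_of_int k - h, 0)"
  shows "K \<subseteq> S"
proof (rule invariant_subset[where J = "{0..B - 1}"])
  show "\<exists>k\<in>{0..B - 1}. \<exists>y\<in>K. x = f (real_of_int k - h) y" if "x \<in> K" for x
    using assms(2)[OF that] f_eq_iff by (metis atLeastAtMost_iff)
qed (use assms(1) S_fI compact_S compact_imp_closed S_nonempty in auto)

subsection \<open>Overlaps of lattice translates\<close>

lemma inj_M: "inj M"
proof -
  have "real_of_int B \<noteq> 0" using B_ge_3 by simp
  then show ?thesis by (auto simp: inj_on_def M_def prod_eq_iff)
qed

lemma M_add: "M (x + y) = M x + M y" and M_minus: "M (- x) = - M x"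
  by (auto simp: M_def algebra_simps)

lemma M_S: "M ` S = (\<Union>k\<in>{0..B - 1}. (+) (real_of_int k - h, 0) ` S)"
proof -
  have "M x \<in> (\<Union>k\<in>{0..B - 1}. (+) (real_of_int k - h, 0) ` S)" if x: "x \<in> S" for x
  proof -
    obtain k y where "0 \<le> k" "k \<le> B - 1" "y \<in> S" "x = f (real_of_int k - h) y"
      using S_fD[OF x] by blast
    then have "M x = (real_of_int k - h, 0) + y" by (simp add: add.commute)
    then show ?thesis using \<open>0 \<le> k\<close> \<open>k \<le> B - 1\<close> \<open>y \<in> S\<close> by auto
  qed
  moreover have "(real_of_int k - h, 0) + y \<in> M ` S" if "0 \<le> k" "k \<le> B - 1" "y \<in> S" for k y
  proof -
    have "M (f (real_of_int k - h) y) = (real_of_int k - h, 0) + y" by (simp add: add.commute)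
    then show ?thesis using S_fI[OF that(3,1,2)] by (metis imageI)
  qed
  ultimately show ?thesis by (intro equalityI subsetI) auto
qed

lemma measure_M_image:
  assumes "compact E"
  shows "measure lebesgue (M ` E) = B * measure lebesgue E"
proof -
  have "compact (M ` E)" using assms unfolding M_def
    by (intro compact_continuous_image continuous_intros)
  then have *: "M ` E \<in> sets borel" "E \<in> sets borel" using assms by (auto simp: borel_compact)
  have em: "emeasure lborel (M ` E) = ennreal B * emeasure lborel E"
    unfolding M_def using B_ge_3 by (intro emeasure_companion_image assms) simp
  have leb: "measure lebesgue X = enn2real (emeasure lborel X)" if "X \<in> sets borel" for X :: "(real \<times> real) set"
    using measure_completion[of X lborel] that unfolding measure_def[of lborel] sets_lborel by blast
  have "measure lebesgue (M ` E) = enn2real (ennreal B * emeasure lborel E)"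
    unfolding leb[OF *(1)] em ..
  also have "\<dots> = B * enn2real (emeasure lborel E)" using B_ge_3 by (simp only: enn2real_mult) simp
  also have "\<dots> = B * measure lebesgue E"
    unfolding leb[OF *(2)] ..
  finally show ?thesis .
qed

definition overlap_null :: "real \<times> real \<Rightarrow> bool" where
  "overlap_null v \<longleftrightarrow> negligible (S \<inter> (+) v ` S)"

lemma translate_Int: "(+) a ` (S \<inter> (+) v ` S) = (+) a ` S \<inter> (+) (a + v) ` S"
  by (auto simp: image_iff add.assoc)

lemma overlap_null_minus: "overlap_null v \<Longrightarrow> overlap_null (- v)"
  unfolding overlap_null_def
  using negligible_translation[of "S \<inter> (+) v ` S" "- v"] translate_Int[of "- v" v]
  by (simp add: Int_commute)

lemma overlap_null_translate:
  assumes "negligible ((+) a ` S \<inter> (+) (a + v) ` S)" shows "overlap_null v"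
  unfolding overlap_null_def
  by (rule negligible_translation_rev[of a]) (use assms translate_Int[of a v] in simp)

lemma digit_pair:
  assumes "\<bar>\<delta>\<bar> \<le> B - 1"
  obtains i j where "i \<in> {0..B - 1}" "j \<in> {0..B - 1}" "\<delta> = j - i"
proof (cases "\<delta> \<ge> 0")
  case True
  then show thesis using assms by (intro that[of 0 \<delta>]) auto
next
  case False
  then show thesis using assms by (intro that[of "- \<delta>" 0]) auto
qed

lemma overlap_null_digit:
  assumes "\<bar>\<delta>\<bar> \<le> B - 1" "\<delta> \<noteq> 0"
  shows "overlap_null (real_of_int \<delta>, 0)"
proof -
  obtain i j where ij: "i \<in> {0..B - 1}" "j \<in> {0..B - 1}" "\<delta> = j - i" using digit_pair[OF assms(1)] .
  define E where "E k = (+) (real_of_int k - h, 0) ` S" for k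
  have comp: "compact (E k)" for k unfolding E_def by (rule compact_translation[OF compact_S])
  have "measure lebesgue (\<Union>k\<in>{0..B - 1}. E k) = measure lebesgue (M ` S)"
    unfolding E_def M_S ..
  also have "\<dots> = (\<Sum>k\<in>{0..B - 1}. measure lebesgue (E k))"
    unfolding measure_M_image[OF compact_S] E_def measure_translation using B_ge_3 by simp
  finally have "measure lebesgue (E i \<inter> E j) = 0"
    using ij assms(2) comp by (intro null_Int_of_additive_Union[where I = "{0..B - 1}"]) (auto simp: lmeasurable_compact)
  then have "negligible (E i \<inter> E j)"
    using comp by (simp add: negligible_iff_measure0 lmeasurable_compact compact_Int)
  moreover have "E j = (+) ((real_of_int i - h, 0) + (real_of_int \<delta>, 0)) ` S" by (simp add: E_def ij)
  ultimately show ?thesis unfolding E_def by (intro overlap_null_translate[of "(real_of_int i - h, 0)"]) simp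
qed

lemma overlap_null_step:
  assumes "overlap_null u" "\<bar>\<delta>\<bar> \<le> B - 1"
  shows "overlap_null (M u + (real_of_int \<delta>, 0))"
proof -
  obtain i j where ij: "i \<in> {0..B - 1}" "j \<in> {0..B - 1}" "\<delta> = j - i" using digit_pair[OF assms(2)] .
  let ?a = "(real_of_int i - h, 0)" and ?b = "(real_of_int j - h, 0)"
  have "compact (S \<inter> (+) u ` S)" by (intro compact_Int compact_translation compact_S)
  then have "measure lebesgue (M ` (S \<inter> (+) u ` S)) = 0" "compact (M ` (S \<inter> (+) u ` S))"
    using assms(1) measure_M_image unfolding overlap_null_def
    by (auto simp: negligible_iff_measure M_def intro!: compact_continuous_image continuous_intros)
  then have neg: "negligible (M ` (S \<inter> (+) u ` S))"
    by (simp add: negligible_iff_measure0 lmeasurable_compact)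
  have "(+) ?a ` S \<inter> (+) (?a + (M u + (real_of_int \<delta>, 0))) ` S \<subseteq> M ` (S \<inter> (+) u ` S)"
  proof
    fix x assume "x \<in> (+) ?a ` S \<inter> (+) (?a + (M u + (real_of_int \<delta>, 0))) ` S"
    then obtain y z where yz: "y \<in> S" "x = ?a + y" "z \<in> S" "x = ?a + (M u + (real_of_int \<delta>, 0)) + z"
      by (elim IntE imageE) (rule that)
    have "?a + y \<in> M ` S" "?b + z \<in> M ` S"
      unfolding M_S using yz ij(1,2) by - (rule UN_I imageI; assumption?)+
    then obtain y' z' where y': "y' \<in> S" "?a + y = M y'" "z' \<in> S" "?b + z = M z'" by (elim imageE) (rule that)
    have "x = M u + (?b + z)" using yz(4) by (simp add: ij(3) prod_eq_iff)
    also have "\<dots> = M (u + z')" by (simp only: M_add y')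
    finally have "M y' = M (u + z')" using y'(2) yz(2) by simp
    then have "y' = u + z'" using inj_M by (simp add: inj_eq)
    then show "x \<in> M ` (S \<inter> (+) u ` S)" using y'(1-3) yz(2) by (intro image_eqI[of _ _ y']) auto
  qed
  then show ?thesis using neg negligible_subset overlap_null_translate by blast
qed

text \<open>With this sign \<sigma> A = -|A|, which spares separate treatment of positive and
  negative \<open>A\<close>.\<close>

definition \<sigma> :: int where "\<sigma> = - sgn A"

lemma \<sigma>_cases: "\<sigma> = 1 \<and> \<bar>A\<bar> = - A \<or> \<sigma> = - 1 \<and> \<bar>A\<bar> = A"
  using abs_A_ge_3 by (auto simp: \<sigma>_def sgn_if abs_if)

text \<open>In the coordinates \<open>(\<sigma> q + A p, p)\<close> the step \<open>u \<mapsto> M u + (\<delta>, 0)\<close> becomes, up to sign,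
  \<open>(p, q) \<mapsto> (q, r)\<close> with \<open>\<delta> = r - \<bar>A\<bar> q + B p\<close>, so both signs of \<open>A\<close> are treated at once.\<close>

lemma lattice_overlap_null:
  assumes "m \<noteq> 0 \<or> n \<noteq> 0"
  shows "overlap_null (real_of_int m, real_of_int n)"
proof -
  define G where "G p q \<longleftrightarrow> p = 0 \<and> q = 0 \<or> overlap_null (real_of_int (\<sigma> * q + A * p), real_of_int p)" for p q
  have flip: "overlap_null (real_of_int a, real_of_int b)"
    if "overlap_null (real_of_int (\<sigma> * a), real_of_int (\<sigma> * b))" for a b
    using \<sigma>_cases that overlap_null_minus[of "(- real_of_int a, - real_of_int b)"] by auto
  have step: "G q r" if "G p q" "\<bar>r - \<bar>A\<bar> * q + B * p\<bar> \<le> B - 1" for p q r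
  proof (cases "q = 0 \<and> r = 0")
    case False
    let ?d = "r - \<bar>A\<bar> * q + B * p"
    let ?u = "(real_of_int (\<sigma> * q + A * p), real_of_int p)"
    have eq: "M ?u + (real_of_int ?d, 0) = (real_of_int (\<sigma> * (\<sigma> * r + A * q)), real_of_int (\<sigma> * q))"
      using \<sigma>_cases by (auto simp: M_def algebra_simps)
    have "overlap_null (M ?u + (real_of_int ?d, 0))"
    proof (cases "p = 0 \<and> q = 0")
      case True
      then show ?thesis using overlap_null_digit[of r] that(2) False by (simp add: M_def)
    next
      case False
      then show ?thesis using that by (intro overlap_null_step) (auto simp: G_def)
    qed
    then show ?thesis unfolding eq G_def by (rule disjI2[OF flip])
  qed (simp add: G_def)
  have G: "G n (\<sigma> * (m - A * n))"
  proof (rule int_pair_reach[OF abs_A_ge_3 A_le, of G])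
    show "G 0 0" by (simp add: G_def)
  qed (rule step)
  have eq: "\<sigma> * (\<sigma> * (m - A * n)) + A * n = m" using \<sigma>_cases by auto
  have "\<not> (n = 0 \<and> \<sigma> * (m - A * n) = 0)" using assms \<sigma>_cases by auto
  then show ?thesis using G unfolding G_def eq by blast
qed

text \<open>Upgrades a null overlap to disjointness of \<open>W\<close> from \<open>S + v\<close>: a
  common point would have points of \<open>W + v\<close> nearby, making the overlap of
  \<open>W\<close> and \<open>W + v\<close> a nonempty open set, which is not null.\<close>

lemma open_subset_disjoint:
  assumes W: "open W" "W \<subseteq> S" "S \<subseteq> closure W" and x: "x \<in> W" "x - v \<in> S" and v: "overlap_null v"
  shows False
proof -
  have "open ((+) (- v) ` W)" using W(1) by (rule open_translation)
  moreover have "x - v \<in> (+) (- v) ` W" using x(1) by (intro image_eqI[of _ _ x]) auto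
  moreover have "x - v \<in> closure W" using x(2) W(3) by blast
  ultimately have "W \<inter> (+) (- v) ` W \<noteq> {}" by (metis disjoint_iff open_Int_closure_eq_empty)
  then obtain y where "y \<in> W" "- v + y \<in> W" by blast
  then obtain y where "y \<in> W" "y + v \<in> W" using that[of "- v + y"] by simp
  then have "y + v \<in> W \<inter> (+) v ` W" by (auto simp: add.commute)
  moreover have "open (W \<inter> (+) v ` W)" using W(1) open_translation by blast
  moreover have "negligible (W \<inter> (+) v ` W)"
    using v unfolding overlap_null_def by (rule negligible_subset) (use W(2) in blast)
  ultimately show False using open_not_negligible by blast
qed

subsection \<open>Points shared by neighbours\<close>

text \<open>The fixed point of \<open>f d\<close>, i.e. the point whose expansion repeats the digit
  \<open>d\<close> forever.\<close>

definition fixpt :: "real \<Rightarrow> real \<times> real" where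
  "fixpt d = (- d / (A + B + 1)) *\<^sub>R (real_of_int A + 1, 1)"

definition \<kappa> :: int where "\<kappa> = B + 1 - \<bar>A\<bar>"

text \<open>Chosen as an eigenvector of \<open>M\<close> for the eigenvalue \<sigma> up to a
  horizontal error: M s = \<sigma> s - (\<kappa>, 0).\<close>

definition s :: "real \<times> real" where "s = (real_of_int (A + \<sigma>), 1)"

lemma \<kappa>_bounds: "1 \<le> \<kappa>" "2 * \<kappa> \<le> B - 1"
  using A_le A_ge by (auto simp: \<kappa>_def)

lemma M_fixpt: "M (fixpt d) = fixpt d + (d, 0)"
proof -
  have "real_of_int (A + B + 1) > 0" using A_le by linarith
  define x where "x = d / (A + B + 1)"
  have "A * x + B * x + x = (A + B + 1) * x" by (simp add: distrib_right)
  also have "\<dots> = d" using \<open>0 < _\<close> by (simp add: x_def)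
  finally have "A * x + B * x + x = d" .
  moreover have "fixpt d = (- x) *\<^sub>R (real_of_int A + 1, 1)" by (simp add: fixpt_def x_def)
  ultimately show ?thesis by (simp add: M_def algebra_simps)
qed

lemma f_fixpt: "f d (fixpt d) = fixpt d"
  by (simp add: f_eq_iff M_fixpt)

lemma M_s: "M s = real_of_int \<sigma> *\<^sub>R s - (real_of_int \<kappa>, 0)"
  using \<sigma>_cases by (auto simp: M_def s_def \<kappa>_def algebra_simps)

lemma M_scale: "M (r *\<^sub>R x) = r *\<^sub>R M x"
  by (simp add: M_def algebra_simps)

lemma \<sigma>_scale_cases: "real_of_int \<sigma> *\<^sub>R x = x \<or> real_of_int \<sigma> *\<^sub>R x = - (x :: real \<times> real)"
  using \<sigma>_cases by auto

lemma S_stepI: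
  assumes "y \<in> S" "M x = y + (real_of_int k - h, 0)" "0 \<le> k" "k \<le> B - 1"
  shows "x \<in> S"
  using S_fI[OF assms(1,3,4)] assms(2) f_eq_iff by metis

text \<open>Since \<open>M\<close> sends \<open>s\<close> to \<sigma> s up to a horizontal shift,
  displacing a point by r s merely changes its digit by r \<kappa>.\<close>

lemma M_pm:
  fixes d r :: real
  assumes "M a = b + (d, 0)"
  shows "M (a + r *\<^sub>R s) = (b + real_of_int \<sigma> *\<^sub>R (r *\<^sub>R s)) + (d - r * \<kappa>, 0)"
    and "M (a - r *\<^sub>R s) = (b - real_of_int \<sigma> *\<^sub>R (r *\<^sub>R s)) + (d + r * \<kappa>, 0)"
proof -
  have "M (r *\<^sub>R s) = real_of_int \<sigma> *\<^sub>R (r *\<^sub>R s) - (r * \<kappa>, 0)"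
    unfolding M_scale M_s by (simp add: scaleR_diff_right)
  then show "M (a + r *\<^sub>R s) = (b + real_of_int \<sigma> *\<^sub>R (r *\<^sub>R s)) + (d - r * \<kappa>, 0)"
    and "M (a - r *\<^sub>R s) = (b - real_of_int \<sigma> *\<^sub>R (r *\<^sub>R s)) + (d + r * \<kappa>, 0)"
    by (simp_all only: M_add diff_conv_add_uminus M_minus assms) (simp_all add: prod_eq_iff)
qed

text \<open>The two points form an invariant set for the expansion: \<open>M\<close> fixes or swaps
  them according to \<sigma>, with digits \<open>k\<close> and \<open>l\<close>.\<close>

lemma fixpt_pm_in_S:
  fixes d r :: real
  assumes k: "real_of_int k - h = d - r * \<kappa>" "0 \<le> k" "k \<le> B - 1"
    and l: "real_of_int l - h = d + r * \<kappa>" "0 \<le> l" "l \<le> B - 1"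
  shows "fixpt d + r *\<^sub>R s \<in> S \<and> fixpt d - r *\<^sub>R s \<in> S"
proof -
  let ?K = "{fixpt d + r *\<^sub>R s, fixpt d - r *\<^sub>R s}"
  have "?K \<subseteq> S"
  proof (rule subset_S)
    fix x assume "x \<in> ?K"
    then show "\<exists>k y. 0 \<le> k \<and> k \<le> B - 1 \<and> y \<in> ?K \<and> M x = y + (real_of_int k - h, 0)"
    proof (elim insertE emptyE)
      assume x: "x = fixpt d + r *\<^sub>R s"
      show ?thesis
        using k M_pm(1)[OF M_fixpt, of d r] \<sigma>_scale_cases[of "r *\<^sub>R s"] unfolding x
        by (intro exI[of _ k] exI[of _ "fixpt d + real_of_int \<sigma> *\<^sub>R (r *\<^sub>R s)"]) auto
    next
      assume x: "x = fixpt d - r *\<^sub>R s"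
      show ?thesis
        using l M_pm(2)[OF M_fixpt, of d r] \<sigma>_scale_cases[of "r *\<^sub>R s"] unfolding x
        by (intro exI[of _ l] exI[of _ "fixpt d - real_of_int \<sigma> *\<^sub>R (r *\<^sub>R s)"]) auto
    qed
  qed simp
  then show ?thesis by simp
qed

text \<open>Here \<open>2\<bar>A\<bar> \<ge> B + 3\<close> enters: the digit difference \<open>2\<kappa>\<close> must not exceed \<open>B - 1\<close>.\<close>

lemma double_s_neighbour: "\<exists>p. p \<in> S \<and> p - 2 *\<^sub>R s \<in> S"
proof -
  \<comment> \<open>The centre is chosen so that the two digits, which differ by 2 \<kappa>, are 0
    and 2 \<kappa>.\<close>
  have "fixpt (\<kappa> - h) + 1 *\<^sub>R s \<in> S \<and> fixpt (\<kappa> - h) - 1 *\<^sub>R s \<in> S"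
    by (rule fixpt_pm_in_S[where k = 0 and l = "2 * \<kappa>"]) (use \<kappa>_bounds in auto)
  then have "fixpt (\<kappa> - h) + s \<in> S" "fixpt (\<kappa> - h) + s - 2 *\<^sub>R s \<in> S" by (simp_all add: scaleR_2)
  then show ?thesis by blast
qed

text \<open>The bound 2 \<kappa> \<le> B - 1 leaves room for two digit pairs, (0, \<kappa>) and (1,
  \<kappa> + 1), so two maps preserve the set of midpoints. Were it finite, both would permute it
  and keep the sum of second coordinates; but those of the two images always differ by 1/B.\<close>

lemma half_s_infinite: "infinite {a. a + (1/2) *\<^sub>R s \<in> S \<and> a - (1/2) *\<^sub>R s \<in> S}" (is "infinite ?Y")
proof
  assume fin: "finite ?Y"
  define d where "d j = \<kappa> / 2 - h + real_of_int j" for j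
  have sub: "f (d j) ` ?Y \<subseteq> ?Y" if "j = 0 \<or> j = 1" for j
  proof (rule image_subsetI)
    fix a assume a: "a \<in> ?Y"
    have both: "a + real_of_int \<sigma> *\<^sub>R ((1/2) *\<^sub>R s) \<in> S" "a - real_of_int \<sigma> *\<^sub>R ((1/2) *\<^sub>R s) \<in> S"
      using a \<sigma>_cases by auto
    have j: "0 \<le> j" "j \<le> B - 1" "0 \<le> \<kappa> + j" "\<kappa> + j \<le> B - 1" using that \<kappa>_bounds by auto
    have "d j - 1/2 * \<kappa> = real_of_int j - h" "d j + 1/2 * \<kappa> = real_of_int (\<kappa> + j) - h"
      by (simp_all add: d_def field_simps)
    then have "f (d j) a + (1/2) *\<^sub>R s \<in> S" "f (d j) a - (1/2) *\<^sub>R s \<in> S"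
      using S_stepI[OF both(1) _ j(1,2)] S_stepI[OF both(2) _ j(3,4)] M_pm[OF M_f[of "d j" a], of "1/2"]
      by metis+
    then show "f (d j) a \<in> ?Y" by blast
  qed
  have sum: "(\<Sum>x\<in>?Y. snd (f (d j) x)) = (\<Sum>x\<in>?Y. snd x)" if "j = 0 \<or> j = 1" for j
  proof -
    have "f (d j) ` ?Y = ?Y" by (rule endo_inj_surj[OF fin sub[OF that] inj_f])
    then show ?thesis using sum.reindex[OF inj_f, of snd "d j" ?Y] by (simp add: comp_def)
  qed
  have "(\<Sum>x\<in>?Y. snd (f (d 0) x) - snd (f (d 1) x)) = 0" using sum[of 0] sum[of 1] by (simp add: sum_subtractf)
  moreover have "snd (f (d 0) x) - snd (f (d 1) x) = 1 / B" for x
    by (simp add: f_def d_def diff_divide_distrib add_divide_distrib)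
  ultimately have "card ?Y = 0" using B_ge_3 by simp
  moreover have "fixpt (\<kappa> / 2 - h) \<in> ?Y"
    by (simp, rule fixpt_pm_in_S[where k = 0 and l = \<kappa>]) (use \<kappa>_bounds in auto)
  ultimately show False using card_0_eq[OF fin] by blast
qed

text \<open>One inverse step turns a pair of points differing by \<open>s\<close> into a pair
  differing by (1, 0), because \<open>M\<close> maps (1, 0) to s - (A + \<sigma>, 0). The offset
  \<open>d\<close> makes the two digits 0 and |A| - 1.\<close>

lemma unit_neighbour_infinite: "infinite {q. q \<in> S \<and> q - (1, 0) \<in> S}"
proof -
  let ?Y = "{a. a + (1/2) *\<^sub>R s \<in> S \<and> a - (1/2) *\<^sub>R s \<in> S}"
  define d where "d = (real_of_int \<bar>A\<bar> - 1) / 2 - h"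
  define F where "F a = f d a + (1/2, 0)" for a
  have "inj_on F ?Y" unfolding F_def by (rule inj_onI) (use inj_f[of d UNIV] in \<open>simp add: inj_eq\<close>)
  then have "infinite (F ` ?Y)" using half_s_infinite finite_imageD by blast
  moreover have "F ` ?Y \<subseteq> {q. q \<in> S \<and> q - (1, 0) \<in> S}"
  proof (rule image_subsetI)
    fix a assume a: "a \<in> ?Y"
    have half: "M (1/2, 0) = (1/2) *\<^sub>R s - (real_of_int (A + \<sigma>) / 2, 0)" by (simp add: M_def s_def)
    have p: "M (F a) = (a + (1/2) *\<^sub>R s) + (d - real_of_int (A + \<sigma>) / 2, 0)"
      unfolding F_def M_add half by simp
    have "F a - (1, 0) = f d a + - (1/2, 0)" by (simp add: F_def prod_eq_iff)
    then have m: "M (F a - (1, 0)) = (a - (1/2) *\<^sub>R s) + (d + real_of_int (A + \<sigma>) / 2, 0)"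
      by (simp only: M_add M_minus half M_f) simp
    show "F a \<in> {q. q \<in> S \<and> q - (1, 0) \<in> S}"
      using \<sigma>_cases
    proof (elim disjE conjE)
      assume \<sigma>: "\<sigma> = 1" "\<bar>A\<bar> = - A"
      have "F a \<in> S" by (rule S_stepI[of "a + (1/2) *\<^sub>R s" _ "\<bar>A\<bar> - 1"])
         (use a p \<sigma> A_le abs_A_ge_3 in \<open>auto simp: d_def field_simps\<close>)
      moreover have "F a - (1, 0) \<in> S" by (rule S_stepI[of "a - (1/2) *\<^sub>R s" _ 0])
         (use a m \<sigma> B_ge_3 in \<open>auto simp: d_def field_simps\<close>)
      ultimately show ?thesis by blast
    next
      assume \<sigma>: "\<sigma> = - 1" "\<bar>A\<bar> = A"
      have "F a \<in> S" by (rule S_stepI[of "a + (1/2) *\<^sub>R s" _ 0])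
         (use a p \<sigma> B_ge_3 in \<open>auto simp: d_def field_simps\<close>)
      moreover have "F a - (1, 0) \<in> S" by (rule S_stepI[of "a - (1/2) *\<^sub>R s" _ "\<bar>A\<bar> - 1"])
         (use a m \<sigma> A_le abs_A_ge_3 in \<open>auto simp: d_def field_simps\<close>)
      ultimately show ?thesis by blast
    qed
  qed
  ultimately show ?thesis using finite_subset by blast
qed

end

section \<open>Lattice cosets, crossing paths and chains of translates\<close>

definition lattice_vec :: "real \<times> real \<Rightarrow> bool" where
  "lattice_vec v \<longleftrightarrow> (\<exists>m n :: int. v = (real_of_int m, real_of_int n))"

lemma lattice_vec_add: "lattice_vec v \<Longrightarrow> lattice_vec w \<Longrightarrow> lattice_vec (v + w)"
  unfolding lattice_vec_def by (metis add_Pair of_int_add)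

lemma lattice_vec_minus: "lattice_vec (- v) \<longleftrightarrow> lattice_vec v"
proof -
  have "lattice_vec (- v)" if "lattice_vec v" for v
    using that unfolding lattice_vec_def by (metis of_int_minus uminus_Pair)
  from this[of v] this[of "- v"] show ?thesis by auto
qed

lemma finite_bounded_lattice_coset:
  assumes "bounded S"
  shows "finite {x \<in> S. lattice_vec (x - z)}"
proof -
  obtain R where R: "\<And>x. x \<in> S \<Longrightarrow> norm x \<le> R" using assms bounded_iff by metis
  define N where "N = \<lceil>R + norm z\<rceil>"
  have "{x \<in> S. lattice_vec (x - z)} \<subseteq> (\<lambda>(m, n). z + (real_of_int m, real_of_int n)) ` ({-N..N} \<times> {-N..N})"
  proof (clarify)
    fix a b assume x: "(a, b) \<in> S" "lattice_vec ((a, b) - z)"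
    then obtain m n :: int where mn: "(a, b) - z = (real_of_int m, real_of_int n)" by (auto simp: lattice_vec_def)
    have "norm ((a, b) - z) \<le> R + norm z" using R[OF x(1)] norm_triangle_ineq4[of "(a, b)" z] by linarith
    then have "norm (real_of_int m, real_of_int n) \<le> R + norm z" by (simp only: mn)
    then have "\<bar>real_of_int m\<bar> \<le> R + norm z" "\<bar>real_of_int n\<bar> \<le> R + norm z"
      using norm_fst_le[of "real_of_int m" "real_of_int n"] norm_snd_le[of "real_of_int n" "real_of_int m"]
      unfolding real_norm_def by linarith+
    then have "\<bar>m\<bar> \<le> N" "\<bar>n\<bar> \<le> N" unfolding N_def by linarith+
    moreover have "(a, b) = z + (real_of_int m, real_of_int n)" using mn by (metis add.commute diff_add_cancel)
    ultimately show "(a, b) \<in> (\<lambda>(m, n). z + (real_of_int m, real_of_int n)) ` ({-N..N} \<times> {-N..N})"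
      by (intro image_eqI[of _ _ "(m, n)"]) auto
  qed
  then show ?thesis using finite_subset by blast
qed

text \<open>In the sheared coordinates \<open>snd\<close> and \<open>fst - c * snd\<close>, the path
  \<open>g\<close> passes from below \<open>g'\<close> to above it while \<open>g'\<close> passes
  from the left of \<open>g\<close> to its right. The difference of the two paths then satisfies the
  hypotheses of \<open>poincare_miranda\<close>.\<close>

lemma paths_cross:
  fixes g g' :: "real \<Rightarrow> real \<times> real" and c :: real
  assumes g: "path g" and g': "path g'"
    and 1: "\<And>z. z \<in> path_image g' \<Longrightarrow> snd (pathstart g) < snd z \<and> snd z < snd (pathfinish g)"
    and 2: "\<And>z. z \<in> path_image g \<Longrightarrow> fst (pathstart g') - c * snd (pathstart g') < fst z - c * snd z
              \<and> fst z - c * snd z < fst (pathfinish g') - c * snd (pathfinish g')"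
  shows "path_image g \<inter> path_image g' \<noteq> {}"
proof -
  define F where "F x = (snd (g (fst x)) - snd (g' (snd x)),
     fst (g (fst x)) - c * snd (g (fst x)) - (fst (g' (snd x)) - c * snd (g' (snd x))))" for x :: "real \<times> real"
  have cont: "continuous_on (cbox (0,0) (1,1)) (\<lambda>x. g (fst x))" "continuous_on (cbox (0,0) (1,1)) (\<lambda>x. g' (snd x))"
    using g g' unfolding path_def
    by (auto intro!: continuous_on_compose2[of "{0..1}" g] continuous_on_compose2[of "{0..1}" g'] continuous_intros)
  have im: "g t \<in> path_image g" "g' t \<in> path_image g'" if "0 \<le> t" "t \<le> 1" for t
    using that by (auto simp: path_image_def)
  have "\<exists>x\<in>cbox (0,0) (1,1). F x = 0"
  proof (rule poincare_miranda)
    show "continuous_on (cbox (0, 0) (1, 1)) F" unfolding F_def by (intro continuous_intros cont)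
    show "fst (F (0, t)) < 0" "fst (F (1, t)) > 0" "snd (F (t, 0)) > 0" "snd (F (t, 1)) < 0" if "0 \<le> t" "t \<le> 1" for t
      using 1[OF im(2)[OF that]] 2[OF im(1)[OF that]] by (auto simp: F_def pathstart_def pathfinish_def)
  qed
  then obtain a b where ab: "0 \<le> a" "a \<le> 1" "0 \<le> b" "b \<le> 1" "F (a, b) = 0" by auto
  have *: "snd (g a) = snd (g' b)" "fst (g a) - c * snd (g a) = fst (g' b) - c * snd (g' b)"
  proof -
    have "fst (F (a, b)) = 0" "snd (F (a, b)) = 0" using ab(5) by simp_all
    then show "snd (g a) = snd (g' b)" "fst (g a) - c * snd (g a) = fst (g' b) - c * snd (g' b)"
      unfolding F_def fst_conv snd_conv by linarith+
  qed
  from *(2) have "fst (g a) = fst (g' b)" unfolding *(1) by simp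
  with *(1) have "g a = g' b" by (simp add: prod_eq_iff)
  then show ?thesis using im(1)[OF ab(1,2)] im(2)[OF ab(3,4)] by (metis IntI empty_iff)
qed

definition chain :: "(real \<times> real) set \<Rightarrow> real \<times> real \<Rightarrow> (real \<times> real) set" where
  "chain X w = {x + real_of_int k *\<^sub>R w | x k. x \<in> X}"

lemma path_component_translate:
  fixes a :: "'a::real_normed_vector"
  assumes "path_component X x y"
  shows "path_component ((+) a ` X) (a + x) (a + y)"
proof -
  obtain g where g: "path g" "path_image g \<subseteq> X" "pathstart g = x" "pathfinish g = y"
    using assms by (auto simp: path_component_def)
  then show ?thesis unfolding path_component_def
    by (intro exI[of _ "(\<lambda>x. a + x) \<circ> g"])
       (auto simp: path_translation_eq path_image_translation pathstart_translation pathfinish_translation)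
qed

lemma path_component_uminus:
  fixes x :: "'a::real_normed_vector"
  assumes "path_component X x y"
  shows "path_component (uminus ` X) (- x) (- y)"
proof -
  obtain g where g: "path g" "path_image g \<subseteq> X" "pathstart g = x" "pathfinish g = y"
    using assms by (auto simp: path_component_def)
  then show ?thesis unfolding path_component_def
    by (intro exI[of _ "uminus \<circ> g"])
       (auto simp: path_image_compose pathstart_compose pathfinish_compose intro!: path_continuous_image continuous_intros)
qed

lemma chain_path_component:
  assumes "path_component X (a - w) a"
  shows "path_component (chain X w) (a - real n *\<^sub>R w) (a + real n *\<^sub>R w)"
proof -
  have step: "path_component (chain X w) (a + real_of_int (k - 1) *\<^sub>R w) (a + real_of_int k *\<^sub>R w)" for k
  proof -
    have "(+) (real_of_int k *\<^sub>R w) ` X \<subseteq> chain X w" by (auto simp: chain_def add.commute)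
    from path_component_of_subset[OF this path_component_translate[OF assms]]
    show ?thesis by (simp add: algebra_simps)
  qed
  have "path_component (chain X w) (a - real n *\<^sub>R w) (a + real_of_int (int m - int n) *\<^sub>R w)" for m
  proof (induction m)
    case 0
    have "path_component (chain X w) (a - real n *\<^sub>R w) (a - real n *\<^sub>R w)"
      using path_component_mem(2)[OF step[of "- int n"]] by (simp add: path_component_refl)
    then show ?case by simp
  next
    case (Suc m)
    have "int (Suc m) - int n - 1 = int m - int n" by simp
    then show ?case using path_component_trans[OF Suc] step[of "int (Suc m) - int n"] by metis
  qed
  from this[of "2 * n"] show ?thesis by simp
qed

section \<open>Common points of the tile and its reflection, and the contradiction\<close>

context p2_tile begin

text \<open>Digit 1 is allowed for both \<open>T\<close> and \<open>-T\<close>, so its inverse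
  branch maps their intersection injectively into itself. On a finite set this is a permutation, and
  a bounded set that a contraction maps onto itself lies in its fixed point.\<close>

lemma finite_symmetric_tile_points:
  assumes "finite {x. x \<in> T \<and> - x \<in> T}"
  shows "{x. x \<in> T \<and> - x \<in> T} \<subseteq> {fixpt (1 - h)}" (is "?P \<subseteq> _")
proof -
  have B2: "0 \<le> (1::int)" "1 \<le> B - 2" "(1::int) \<le> 1" "1 \<le> B - 1" using B_ge_3 by linarith+
  have "f (1 - h) ` ?P \<subseteq> ?P"
  proof (rule image_subsetI)
    fix x assume "x \<in> ?P"
    then show "f (1 - h) x \<in> ?P" using tile_fI(1)[of x 1] neg_tile_fI[of x 1] B2 by simp
  qed
  then have surj: "f (1 - h) ` ?P = ?P" by (rule endo_inj_surj[OF assms _ inj_f])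
  show ?thesis
  proof (rule invariant_subset[where J = "{1}"])
    show "\<exists>k\<in>{1}. \<exists>y\<in>?P. x = f (real_of_int k - h) y" if "x \<in> ?P" for x
    proof -
      have "x \<in> f (1 - h) ` ?P" by (rule subsetD[OF equalityD2[OF surj] that])
      then have "\<exists>y\<in>?P. x = f (1 - h) y" by blast
      then show ?thesis by simp
    qed
    show "bounded ?P" using assms by (rule finite_imp_bounded)
  qed (auto simp: f_fixpt)
qed

text \<open>For \<open>B = 3\<close> only one digit keeps both \<open>T\<close> and \<open>-T\<close> invariant, so a second point is given by
  its two eventually periodic expansions.\<close>

lemma symmetric_tile_points_nonfix: "\<exists>x. x \<in> T \<and> - x \<in> T \<and> x \<noteq> fixpt (1 - h)"
proof (cases "B = 3")
  case False
  then have B4: "B \<ge> 4" using B_ge_3 by simp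
  \<comment> \<open>For B \<ge> 4 digit 2 also lies between 1 and B - 2, so its fixed point is in
    both \<open>T\<close> and \<open>-T\<close>.\<close>
  have "{fixpt (2 - h)} \<subseteq> T"
  proof (rule invariant_subset[where J = "{2}"])
    show "closed T" using compact_tile by (rule compact_imp_closed)
    show "T \<noteq> {}" by (rule tile_nonempty)
    show "f (real_of_int k - h) x \<in> T" if "k \<in> {2}" "x \<in> T" for k x
      by (rule tile_fI(1)) (use that B4 in auto)
  qed (auto simp: f_fixpt)
  moreover have "{fixpt (2 - h)} \<subseteq> uminus ` T"
  proof (rule invariant_subset[where J = "{2}"])
    show "closed (uminus ` T)" using compact_tile
      by (intro compact_imp_closed compact_continuous_image continuous_intros)
    show "uminus ` T \<noteq> {}" using tile_nonempty by blast
    show "f (real_of_int k - h) x \<in> uminus ` T" if "k \<in> {2}" "x \<in> uminus ` T" for k x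
    proof -
      have "- f (real_of_int k - h) x \<in> T" by (rule neg_tile_fI) (use that B4 in auto)
      then show ?thesis by (metis image_eqI minus_minus)
    qed
  qed (auto simp: f_fixpt)
  moreover have "fixpt (2 - h) \<noteq> fixpt (1 - h)"
  proof
    assume "fixpt (2 - h) = fixpt (1 - h)"
    moreover have "real_of_int (A + B + 1) \<noteq> 0" using A_le by linarith
    ultimately show False by (auto simp: fixpt_def)
  qed
  ultimately show ?thesis by (intro exI[of _ "fixpt (2 - h)"]) auto
next
  case True
  have h: "h = 1" unfolding h_def using True by simp
  have Bs: "0 < B" "1 < B" "2 < B" "1 \<le> B" "2 \<le> B" using True by simp_all
  have fix0: "fixpt (1 - h) = 0" by (simp add: h fixpt_def zero_prod_def)
  have "A = 3 \<or> A = -3" using abs_A_ge_3 A_le True by linarith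
  then show ?thesis
  proof
    assume A: "A = 3"
    have fA: "f d (x, y) = (y - (x + d), - (x + d) / 3)" for d x y unfolding f_def using A True by simp
    have MA: "M (x, y) = (- 3 * y, x - 3 * y)" for x y unfolding M_def using A True by simp
    \<comment> \<open>The two points form a cycle of \<open>S\<close>. Applying digits 0, 0 to (9/7,
      4/7) ends in \<open>T\<close>, applying digits 2, 1 to (-5/7, -3/7) ends in \<open>-T\<close>,
      and both give (13/21, 5/21).\<close>
    have "{(-5/7, -3/7), (9/7, 4/7)} \<subseteq> S"
    proof (rule subset_S)
      fix x :: "real \<times> real" assume "x \<in> {(-5/7, -3/7), (9/7, 4/7)}"
      then show "\<exists>k y. 0 \<le> k \<and> k \<le> B - 1 \<and> y \<in> {(-5/7, -3/7), (9/7, 4/7)} \<and> M x = y + (real_of_int k - h, 0)"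
      proof (elim insertE emptyE)
        assume "x = (-5/7, -3/7)"
        then show ?thesis
          by (intro exI[of _ 1] exI[of _ "(9/7, 4/7)"]) (simp add: MA Bs h)
      next
        assume "x = (9/7, 4/7)"
        then show ?thesis
          by (intro exI[of _ 0] exI[of _ "(-5/7, -3/7)"]) (simp add: MA Bs h)
      qed
    qed simp
    then have S: "(-5/7, -3/7) \<in> S" "(9/7, 4/7) \<in> S" by auto
    have "(2/7, -2/21) = f (- h) (9/7, 4/7)" by (simp add: fA Bs h)
    then have "(2/7, -2/21) \<in> S" using f_S_in_tile[OF S(2)] S_I(1) by simp
    from f_S_in_tile[OF this] have 1: "(13/21, 5/21) \<in> T" by (simp add: fA Bs h)
    have "- (-5/7, -2/21) \<in> T" using f_S_in_neg_tile[OF S(1)] by (simp add: fA Bs h)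
    from neg_tile_fI[OF this, of 1] have "- (13/21, 5/21) \<in> T" by (simp add: fA Bs h)
    with 1 show ?thesis by (intro exI[of _ "(13/21, 5/21)"]) (simp add: fix0 zero_prod_def)
  next
    assume A: "A = -3"
    have fA: "f d (x, y) = (y + (x + d), - (x + d) / 3)" for d x y unfolding f_def using A True by simp
    have MA: "M (x, y) = (- 3 * y, x + 3 * y)" for x y unfolding M_def using A True by simp
    \<comment> \<open>(2, -1) is the fixed point of digit 2. Digits 2, 2, 0 applied to its negative
      end in \<open>T\<close>, digits 2, 1, 1, 1 applied to it end in \<open>-T\<close>, and both
      give (0, -1/9).\<close>
    have "{(2, -1)} \<subseteq> S"
    proof (rule subset_S)
      show "\<exists>k y. 0 \<le> k \<and> k \<le> B - 1 \<and> y \<in> {(2, -1)} \<and> M x = y + (real_of_int k - h, 0)"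
        if "x \<in> {(2, -1)}" for x using that by (intro exI[of _ 2] exI[of _ "(2, -1)"]) (simp add: MA Bs h)
    qed simp
    then have S: "(2, -1) \<in> S" by simp
    then have "(-2, 1) \<in> S" using minus_S[of "(2, -1)"] by simp
    from S_fI[OF this, of 2] have "(0, 1/3) \<in> S" by (simp add: fA Bs h)
    from S_fI[OF this, of 2] have "(4/3, -1/3) \<in> S" by (simp add: fA Bs h)
    from f_S_in_tile[OF this] have 1: "(0, -1/9) \<in> T" by (simp add: fA Bs h)
    have "- (2, -1) \<in> T" using f_S_in_neg_tile[OF S] by (simp add: fA Bs h)
    from neg_tile_fI[OF this, of 1] have "- (1, -2/3) \<in> T" by (simp add: fA Bs h)
    from neg_tile_fI[OF this, of 1] have "- (1/3, -1/3) \<in> T" by (simp add: fA Bs h)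
    from neg_tile_fI[OF this, of 1] have "- (0, -1/9) \<in> T" by (simp add: fA Bs h)
    with 1 show ?thesis by (intro exI[of _ "(0, -1/9)"]) (simp add: fix0 zero_prod_def)
  qed
qed

lemma symmetric_tile_points_infinite: "infinite {x. x \<in> T \<and> - x \<in> T}"
  using finite_symmetric_tile_points symmetric_tile_points_nonfix by blast

text \<open>Only one link \<open>p\<close> is at hand, but \<open>p0\<close> and then
  \<open>q\<close> come from infinite sets, and a coset of the lattice meets the bounded set
  \<open>S\<close> in finitely many points.\<close>

lemma noncongruent_links:
  obtains p p0 q where "p \<in> S" "p - 2 *\<^sub>R s \<in> S" "p0 \<in> T" "- p0 \<in> T" "q \<in> S" "q - (1, 0) \<in> S"
    "\<not> lattice_vec (p0 - p)" "\<not> lattice_vec (q - p)" "\<not> lattice_vec (q - p0)"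
proof -
  obtain p where p: "p \<in> S" "p - 2 *\<^sub>R s \<in> S" using double_s_neighbour by blast
  have fin: "finite {x \<in> S. lattice_vec (x - z)}" for z
    by (rule finite_bounded_lattice_coset) (rule compact_imp_bounded[OF compact_S])
  have "infinite ({x. x \<in> T \<and> - x \<in> T} - {x \<in> S. lattice_vec (x - p)})"
    using symmetric_tile_points_infinite fin by (rule Diff_infinite_finite[rotated])
  then obtain p0 where p0: "p0 \<in> {x. x \<in> T \<and> - x \<in> T} - {x \<in> S. lattice_vec (x - p)}"
    using infinite_imp_nonempty by blast
  have "infinite ({q. q \<in> S \<and> q - (1, 0) \<in> S} - ({x \<in> S. lattice_vec (x - p)} \<union> {x \<in> S. lattice_vec (x - p0)}))"
    using unit_neighbour_infinite fin by (intro Diff_infinite_finite finite_UnI)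
  then obtain q where q: "q \<in> {q. q \<in> S \<and> q - (1, 0) \<in> S} - ({x \<in> S. lattice_vec (x - p)} \<union> {x \<in> S. lattice_vec (x - p0)})"
    using infinite_imp_nonempty by blast
  show thesis by (rule that[of p p0 q]) (use p p0 q S_I(1) in blast)+
qed

text \<open>Each end is joined to \<open>p0\<close> inside its own half, \<open>T\<close> or
  \<open>-T\<close>; \<open>p0\<close> belongs to both halves.\<close>

lemma tile_links_in_S:
  assumes U: "\<And>p q. p \<in> T \<Longrightarrow> q \<in> T \<Longrightarrow> path_component (insert p (insert q U)) p q"
    and p0: "p0 \<in> T" "- p0 \<in> T" and ab: "a \<in> S" "b \<in> S"
  shows "path_component (insert a (insert b (insert p0 (U \<union> uminus ` U)))) a b"
proof -
  have *: "path_component (insert x (insert p0 (U \<union> uminus ` U))) x p0" if "x \<in> S" for x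
    using that
  proof (cases rule: S_cases)
    case 1
    show ?thesis by (rule path_component_of_subset[OF _ U[OF 1 p0(1)]]) blast
  next
    case 2
    have "path_component (insert x (insert p0 (uminus ` U))) x p0"
      using path_component_uminus[OF U[OF 2 p0(2)]] by simp
    then show ?thesis by (rule path_component_of_subset[rotated]) blast
  qed
  have "path_component (insert a (insert b (insert p0 (U \<union> uminus ` U)))) a p0"
    by (rule path_component_of_subset[OF _ *[OF ab(1)]]) blast
  moreover have "path_component (insert a (insert b (insert p0 (U \<union> uminus ` U)))) b p0"
    by (rule path_component_of_subset[OF _ *[OF ab(2)]]) blast
  ultimately show ?thesis using path_component_trans path_component_sym by blast
qed

text \<open>\<open>fst - c * snd\<close> is constant along \<open>s\<close>, so the chain of
  \<open>X\<close> stays in a strip parallel to \<open>s\<close>, while the chain of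
  \<open>Y\<close> stays in a horizontal strip. With enough links each chain traverses the strip of
  the other.\<close>

lemma chains_meet:
  assumes X: "X \<subseteq> S" "path_component X (p - 2 *\<^sub>R s) p"
    and Y: "Y \<subseteq> S" "path_component Y (q - (1, 0)) q"
  obtains x y k l where "x \<in> X" "y \<in> Y"
    "x + real_of_int k *\<^sub>R (2 *\<^sub>R s) = (0, 1) + (y + real_of_int l *\<^sub>R (1, 0))"
proof -
  define c where "c = real_of_int (A + \<sigma>)"
  have s: "s = (c, 1)" by (simp add: s_def c_def)
  obtain R0 where R0: "\<And>x. x \<in> S \<Longrightarrow> norm x \<le> R0" using compact_imp_bounded[OF compact_S] bounded_iff by metis
  define R where "R = R0 + \<bar>c\<bar> * R0"
  have bnd: "\<bar>snd x\<bar> \<le> R \<and> \<bar>fst x - c * snd x\<bar> \<le> R" if "x \<in> S" for x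
  proof -
    have 1: "\<bar>fst x\<bar> \<le> R0" "\<bar>snd x\<bar> \<le> R0"
      using R0[OF that] norm_fst_le[of "fst x" "snd x"] norm_snd_le[of "snd x" "fst x"] by auto
    have 2: "\<bar>c * snd x\<bar> \<le> \<bar>c\<bar> * R0" unfolding abs_mult using 1 by (intro mult_left_mono) auto
    moreover have "0 \<le> \<bar>c\<bar> * R0" using 2 by linarith
    ultimately show ?thesis using 1 unfolding R_def by linarith
  qed
  obtain n where n: "real n > 2 * R + \<bar>c\<bar> + 1" using reals_Archimedean2 by blast
  have pq: "p \<in> S" "q \<in> S" using path_component_mem(2)[OF X(2)] path_component_mem(2)[OF Y(2)] X(1) Y(1) by blast+
  obtain g where g: "path g" "path_image g \<subseteq> chain X (2 *\<^sub>R s)"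
      "pathstart g = p - real n *\<^sub>R (2 *\<^sub>R s)" "pathfinish g = p + real n *\<^sub>R (2 *\<^sub>R s)"
    using chain_path_component[OF X(2), of n] unfolding path_component_def by blast
  obtain g' where g': "path g'" "path_image g' \<subseteq> (+) (0, 1) ` chain Y (1, 0)"
      "pathstart g' = (0, 1) + (q - real n *\<^sub>R (1, 0))" "pathfinish g' = (0, 1) + (q + real n *\<^sub>R (1, 0))"
    using path_component_translate[OF chain_path_component[OF Y(2), of n], of "(0, 1)"]
    unfolding path_component_def by blast
  have "path_image g \<inter> path_image g' \<noteq> {}"
  proof (rule paths_cross[OF g(1) g'(1), where c = c])
    fix z assume "z \<in> path_image g'"
    then obtain y l where y: "y \<in> Y" "z = (0, 1) + (y + real_of_int l *\<^sub>R (1, 0))"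
      using g'(2) unfolding chain_def by blast
    have "\<bar>snd y\<bar> \<le> R" "\<bar>snd p\<bar> \<le> R" using bnd y(1) Y(1) pq by blast+
    then show "snd (pathstart g) < snd z \<and> snd z < snd (pathfinish g)"
      using n by (simp add: g y(2) s) linarith
  next
    fix z assume "z \<in> path_image g"
    then obtain x k where x: "x \<in> X" "z = x + real_of_int k *\<^sub>R (2 *\<^sub>R s)"
      using g(2) unfolding chain_def by blast
    have "\<bar>fst x - c * snd x\<bar> \<le> R" "\<bar>fst q - c * snd q\<bar> \<le> R" using bnd x(1) X(1) pq by blast+
    moreover have "fst z - c * snd z = fst x - c * snd x" by (simp add: x(2) s algebra_simps)
    moreover have "fst (pathstart g') - c * snd (pathstart g') = fst q - c * snd q - c - real n"
      "fst (pathfinish g') - c * snd (pathfinish g') = fst q - c * snd q - c + real n"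
      by (simp_all add: g' algebra_simps)
    ultimately show "fst (pathstart g') - c * snd (pathstart g') < fst z - c * snd z
        \<and> fst z - c * snd z < fst (pathfinish g') - c * snd (pathfinish g')"
      using n by linarith
  qed
  then obtain z where z: "z \<in> chain X (2 *\<^sub>R s)" "z \<in> (+) (0, 1) ` chain Y (1, 0)" using g(2) g'(2) by blast
  then obtain x k where x: "x \<in> X" "z = x + real_of_int k *\<^sub>R (2 *\<^sub>R s)" unfolding chain_def by blast
  from z(2) obtain y l where y: "y \<in> Y" "z = (0, 1) + (y + real_of_int l *\<^sub>R (1, 0))" unfolding chain_def by blast
  show thesis using that[OF x(1) y(1)] x(2) y(2) by blast
qed

lemma not_disk: "\<not> disk_like T"
proof
  assume "disk_like T"
  then obtain U where U: "open U" "U \<subseteq> T" "T \<subseteq> closure U"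
    "\<And>p q. p \<in> T \<Longrightarrow> q \<in> T \<Longrightarrow> path_component (insert p (insert q U)) p q"
    using disk_interior_structure by metis
  define W where "W = U \<union> uminus ` U"
  have W: "open W" "W \<subseteq> S"
    using U(1,2) open_negations[OF U(1)] by (auto simp: W_def S_def)
  have SW: "S \<subseteq> closure W"
  proof -
    have "uminus ` closure U \<subseteq> closure (uminus ` U)"
      by (rule image_closure_subset[OF _ closed_closure closure_subset]) (intro continuous_intros)
    then show ?thesis using U(3) unfolding W_def S_def closure_Un by blast
  qed
  obtain p p0 q where p: "p \<in> S" "p - 2 *\<^sub>R s \<in> S" and p0: "p0 \<in> T" "- p0 \<in> T"
    and q: "q \<in> S" "q - (1, 0) \<in> S"
    and nl: "\<not> lattice_vec (p0 - p)" "\<not> lattice_vec (q - p)" "\<not> lattice_vec (q - p0)"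
    by (rule noncongruent_links)
  define X where "X = insert (p - 2 *\<^sub>R s) (insert p (insert p0 W))"
  define Y where "Y = insert (q - (1, 0)) (insert q (insert p0 W))"
  have XY: "X \<subseteq> S" "Y \<subseteq> S" using p q W(2) S_I(1)[OF p0(1)] by (auto simp: X_def Y_def)
  have "path_component X (p - 2 *\<^sub>R s) p" "path_component Y (q - (1, 0)) q"
    unfolding X_def Y_def W_def using tile_links_in_S[OF U(4) p0] p q by blast+
  then obtain x y k l where xy: "x \<in> X" "y \<in> Y"
    and eq: "x + real_of_int k *\<^sub>R (2 *\<^sub>R s) = (0, 1) + (y + real_of_int l *\<^sub>R (1, 0))"
    using chains_meet[OF XY(1) _ XY(2)] by metis
  define m where "m = l - 2 * k * (A + \<sigma>)"
  \<comment> \<open>The doubling of \<open>s\<close> pays off here: one family has even and the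
    other odd vertical offset, so the difference of two offsets is never zero.\<close>
  define n where "n = 1 - 2 * k"
  let ?v = "(real_of_int m, real_of_int n)"
  have diff: "x - y = ?v"
    using eq by (auto simp: prod_eq_iff s_def m_def n_def algebra_simps)
  have "n \<noteq> 0" unfolding n_def by presburger
  then have null: "overlap_null ?v" by (intro lattice_overlap_null) simp
  \<comment> \<open>The crossing point lies in two distinct lattice translates of \<open>S\<close>,
    hence in the open part of neither; \<open>x\<close> and \<open>y\<close> must be link
    points.\<close>
  have "x \<notin> W"
  proof
    assume "x \<in> W"
    moreover have "x - ?v \<in> S" using diff xy(2) XY(2) by (metis diff_diff_eq2 add_diff_cancel_left' subsetD)
    ultimately show False using open_subset_disjoint[OF W SW] null by blast
  qed
  moreover have "y \<notin> W"
  proof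
    assume "y \<in> W"
    moreover have "y - (- ?v) = x" unfolding diff[symmetric] by simp
    then have "y - (- ?v) \<in> S" using xy(1) XY(1) by auto
    ultimately show False using open_subset_disjoint[OF W SW] overlap_null_minus[OF null] by blast
  qed
  ultimately have cases: "x = p - 2 *\<^sub>R s \<or> x = p \<or> x = p0" "y = q - (1, 0) \<or> y = q \<or> y = p0"
    using xy unfolding X_def Y_def by blast+
  have lat0: "lattice_vec 0" "lattice_vec (2 *\<^sub>R s)" "lattice_vec (1, 0)"
    unfolding lattice_vec_def s_def zero_prod_def
    by (metis of_int_0, rule exI[of _ "2 * (A + \<sigma>)"], rule exI[of _ 2], simp, metis of_int_0 of_int_1)
  have "x \<noteq> y" using diff \<open>n \<noteq> 0\<close> by (auto simp: zero_prod_def)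
  \<comment> \<open>Each link point is replaced by its representative modulo the lattice,
    \<open>p\<close>, \<open>q\<close> or \<open>p0\<close>, remembering when it was
    \<open>p0\<close> itself.\<close>
  obtain x' where x': "x' = p \<or> x' = p0 \<and> x = p0" "lattice_vec (x' - x)"
  proof (cases "x = p0")
    case True
    then show thesis using that[of p0] lat0(1) by simp
  next
    case False
    then have "p - x = 0 \<or> p - x = 2 *\<^sub>R s" using cases(1) by auto
    then show thesis using that[of p] lat0 by auto
  qed
  obtain y' where y': "y' = q \<or> y' = p0 \<and> y = p0" "lattice_vec (y' - y)"
  proof (cases "y = p0")
    case True
    then show thesis using that[of p0] lat0(1) by simp
  next
    case False
    then have "q - y = 0 \<or> q - y = (1, 0)" using cases(2) by auto
    then show thesis using that[of q] lat0 by auto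
  qed
  have "lattice_vec (x - y)" unfolding diff lattice_vec_def by blast
  then have "lattice_vec ((x' - x) + (x - y) + - (y' - y))"
    using x'(2) y'(2) lattice_vec_add lattice_vec_minus by blast
  then have 1: "lattice_vec (x' - y')" by simp
  then have 2: "lattice_vec (y' - x')" using lattice_vec_minus[of "x' - y'"] by simp
  \<comment> \<open>Distinct representatives are incongruent by choice, and if both are
    \<open>p0\<close> then x = y.\<close>
  show False using x'(1) y'(1) 1 2 nl \<open>x \<noteq> y\<close> by blast
qed

end

theorem theorem7p2:
  fixes A B :: int
  assumes "\<bar>A\<bar> \<le> B" and "2 * \<bar>A\<bar> \<ge> B + 3"
  shows "\<not> disk_like (tile A B)"
proof -
  interpret p2_tile A B using assms by unfold_locales
  show ?thesis by (rule not_disk)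
qed

end
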